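(* Let $\alpha,\beta,\gamma\in\mathbb{R}$ satisfy $\alpha>-\frac12$, $\gamma>-1$ and $\alpha+\beta+\gamma>-\frac32$, let $X=\{X_t,\ t\ge0\}$ be the continuous modification of $$X_t=\int_0^t s^{\alpha}\int_s^t u^{\beta}(u-s)^{\gamma}\,du\,dW_s,\qquad t\ge 0,$$ where $W$ is a Wiener process, and let $\theta>0$. Let $Z=\{Z_t,\ t\ge0\}$ be the solution of $$Z_t=\theta\int_0^t Z_s\,ds+X_t,\qquad t\ge0.$$ Then the estimator $$\hat\theta_T=\frac{Z_T^2}{2\int_0^T Z_s^2\,ds}$$ is strongly consistent, that is, $\hat\theta_T\to\theta$ almost surely as $T\to\infty$.
   Context: $W=\{W_t,\ t\ge0\}$ is a standard Wiener process, and the outer integral defining $X_t$ is the Wiener integral of the deterministic kernel $K(t,s)=s^\alpha\int_s^t u^\beta(u-s)^\gamma\,du$, $0<s<t$ (with $X_0=0$). Under the stated conditions on $\alpha,\beta,\gamma$ the process $X$ is well defined and has a modification whose paths are (locally) Hölder continuous of every order less than $\lambda=\min(\alpha+\beta+\gamma+\frac32,\ \gamma+\frac32,\ 1)>0$ (known fact); this modification is used. The solution is $Z_t=e^{\theta t}\int_0^t e^{-\theta s}\,dX_s$, where the integral is a pathwise Riemann–Stieltjes integral. *)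

theory Defs
  imports "HOL-Probability.Probability"
begin

definition wiener_process :: "'a measure \<Rightarrow> (real \<Rightarrow> 'a \<Rightarrow> real) \<Rightarrow> bool" where
  "wiener_process M W \<longleftrightarrow>
     prob_space M \<and>
     (\<forall>t\<ge>0. W t \<in> borel_measurable M) \<and>
     (AE \<omega> in M. W 0 \<omega> = 0) \<and>
     (\<forall>s t. 0 \<le> s \<and> s < t \<longrightarrow>
        distributed M lborel (\<lambda>\<omega>. W t \<omega> - W s \<omega>)
          (\<lambda>x. ennreal (normal_density 0 (sqrt (t - s)) x))) \<and>
     (\<forall>n (\<tau> :: nat \<Rightarrow> real). 0 \<le> \<tau> 0 \<and> (\<forall>i<n. \<tau> i \<le> \<tau> (Suc i)) \<longrightarrow>
        prob_space.indep_vars M (\<lambda>_. borel)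
          (\<lambda>i \<omega>. W (\<tau> (Suc i)) \<omega> - W (\<tau> i) \<omega>) {..<n}) \<and>
     (AE \<omega> in M. continuous_on {0..} (\<lambda>t. W t \<omega>))"

(* A step function on the half-line is a list of triples (c, a, b), each standing for
   c times the indicator of (a, b]; the intervals may overlap. *)

type_synonym step_data = "(real \<times> real \<times> real) list"

definition valid_step :: "step_data \<Rightarrow> bool" where
  "valid_step xs \<longleftrightarrow> (\<forall>(c, a, b) \<in> set xs. 0 \<le> a \<and> a \<le> b)"

definition step_fun :: "step_data \<Rightarrow> real \<Rightarrow> real" where
  "step_fun xs s = (\<Sum>(c, a, b)\<leftarrow>xs. c * indicator {a<..b} s)"

definition step_integral :: "(real \<Rightarrow> 'a \<Rightarrow> real) \<Rightarrow> step_data \<Rightarrow> 'a \<Rightarrow> real" where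
  "step_integral W xs \<omega> = (\<Sum>(c, a, b)\<leftarrow>xs. c * (W b \<omega> - W a \<omega>))"

(* Y is a version of the Wiener integral of f over [0, \<infinity>): the extension of step_integral
   by L2 limits.  The limit is determined only up to a null set, whence a relation rather
   than a function.  The first convergence forces f to be square integrable on [0, \<infinity>). *)

definition has_wiener_integral ::
    "'a measure \<Rightarrow> (real \<Rightarrow> 'a \<Rightarrow> real) \<Rightarrow> (real \<Rightarrow> real) \<Rightarrow> ('a \<Rightarrow> real) \<Rightarrow> bool" where
  "has_wiener_integral M W f Y \<longleftrightarrow>
     f \<in> borel_measurable lborel \<and> Y \<in> borel_measurable M \<and>
     (\<exists>\<phi> :: nat \<Rightarrow> step_data.
        (\<forall>n. valid_step (\<phi> n)) \<and>
        (\<lambda>n. \<integral>\<^sup>+s\<in>{0..}. ennreal ((step_fun (\<phi> n) s - f s)\<^sup>2) \<partial>lborel) \<longlonglongrightarrow> 0 \<and>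
        (\<lambda>n. \<integral>\<^sup>+\<omega>. ennreal ((step_integral W (\<phi> n) \<omega> - Y \<omega>)\<^sup>2) \<partial>M) \<longlonglongrightarrow> 0)"

definition gaussian_kernel :: "real \<Rightarrow> real \<Rightarrow> real \<Rightarrow> real \<Rightarrow> real \<Rightarrow> real" where
  "gaussian_kernel \<alpha> \<beta> \<gamma> t s =
     (if 0 < s \<and> s < t
      then s powr \<alpha> * (LBINT u:{s..t}. u powr \<beta> * (u - s) powr \<gamma>)
      else 0)"

(* Any two processes X satisfying this predicate for the same W are indistinguishable. *)

definition continuous_volterra_process ::
    "'a measure \<Rightarrow> (real \<Rightarrow> 'a \<Rightarrow> real) \<Rightarrow> real \<Rightarrow> real \<Rightarrow> real \<Rightarrow> (real \<Rightarrow> 'a \<Rightarrow> real) \<Rightarrow> bool" where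
  "continuous_volterra_process M W \<alpha> \<beta> \<gamma> X \<longleftrightarrow>
     (\<forall>t\<ge>0. has_wiener_integral M W (gaussian_kernel \<alpha> \<beta> \<gamma> t) (X t)) \<and>
     (AE \<omega> in M. continuous_on {0..} (\<lambda>t. X t \<omega>))"

definition langevin_solution ::
    "'a measure \<Rightarrow> real \<Rightarrow> (real \<Rightarrow> 'a \<Rightarrow> real) \<Rightarrow> (real \<Rightarrow> 'a \<Rightarrow> real) \<Rightarrow> bool" where
  "langevin_solution M \<theta> X Z \<longleftrightarrow>
     (\<forall>t\<ge>0. Z t \<in> borel_measurable M) \<and>
     (AE \<omega> in M. \<forall>t\<ge>0.
        set_integrable lborel {0..t} (\<lambda>s. Z s \<omega>) \<and>
        Z t \<omega> = \<theta> * (LBINT s:{0..t}. Z s \<omega>) + X t \<omega>)"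

definition theta_hat :: "(real \<Rightarrow> 'a \<Rightarrow> real) \<Rightarrow> real \<Rightarrow> 'a \<Rightarrow> real" where
  "theta_hat Z T \<omega> = (Z T \<omega>)\<^sup>2 / (2 * (LBINT s:{0..T}. (Z s \<omega>)\<^sup>2))"

end

(* Put I(t) = integral of Z over [0,t]. Then I' = theta I + X, so exp(-theta t) I(t) is the
   integral of exp(-theta s) X_s over [0,t]. If X grows more slowly than exp(theta t), this
   converges to some L, hence exp(-theta t) Z_t converges to theta L, and l'Hospital's rule
   gives the limit theta as soon as L is nonzero.

   Growth: the L2 norm of an increment of the kernel is at most polynomially large times a
   power of the time step that exceeds 1/2, so chaining along dyadic points, which needs only
   second moments, yields |X_t| <= C exp(theta t / 2) almost surely.

   L is nonzero almost surely: the Riemann sums of exp(-theta s) X_s are Wiener integrals of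
   nonnegative kernels which, by monotonicity of K(t,s) in t, dominate a fixed multiple of
   K(1,s). Their variances are bounded below, so P(|sum| <= e) = O(e) uniformly, and this
   bound passes to almost sure limits. *)

theory Submission
  imports Defs "HOL-Real_Asymp.Real_Asymp"
begin

text \<open>A Wiener integral is given only through L2 approximation, so its law is never computed:
  normality is used for step integrals alone. What travels to the limit are two inequalities, a
  bound on second moments and a linear bound on the probability of a small ball. Both survive
  approximation at the price of a constant factor.

  The exponent 1/2 is the threshold for chaining with second moments: level k has 2^k increments per
  unit interval, so their squares have a summable total only if each has second moment of order
  2^(-k(1+d)) with d > 0.

  The moment estimates start at time 1, since u powr \<beta> may be singular at 0; on [0, 1]
  continuity of the path already bounds it. Powers of the end time, whatever the signs of \<alpha>,
  \<beta> and \<gamma>, are absorbed by an arbitrarily small exponential rate.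

  Nonnegativity of the kernels excludes cancellation between different times, so that a lower bound
  on the variance requires no covariance.\<close>

section \<open>Step functions on a common grid\<close>

text \<open>Each interval (a, b] is a union of consecutive cells of p, and increments telescope over
  it; an entry of the list thus adds its coefficient to every cell between its endpoints. The
  coefficients d are chosen before F because the same ones must describe both the step function and
  its integral.\<close>

lemma step_data_grid_aux:
  fixes p :: "real list" and xs :: step_data
  assumes p: "sorted_wrt (<) p"
    and xs: "\<forall>(c, a, b) \<in> set xs. a \<le> b \<and> a \<in> set p \<and> b \<in> set p"
  shows "\<exists>d. \<forall>F :: real \<Rightarrow> real. (\<Sum>(c, a, b)\<leftarrow>xs. c * (F b - F a)) =
           (\<Sum>i<length p - 1. d i * (F (p ! Suc i) - F (p ! i)))"
  using xs
proof (induction xs)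
  case Nil
  show ?case by (rule exI[of _ "\<lambda>_. 0"]) simp
next
  case (Cons x xs)
  obtain c a b where x: "x = (c, a, b)" by (cases x)
  from Cons obtain d where d: "\<And>F :: real \<Rightarrow> real. (\<Sum>(c, a, b)\<leftarrow>xs. c * (F b - F a)) =
           (\<Sum>i<length p - 1. d i * (F (p ! Suc i) - F (p ! i)))" by auto
  from Cons.prems x obtain j k where jk: "j < length p" "k < length p" "p ! j = a" "p ! k = b" "a \<le> b"
    by (auto simp: in_set_conv_nth)
  have "j \<le> k"
  proof (rule ccontr)
    assume "\<not> j \<le> k"
    then have "p ! k < p ! j" using sorted_wrt_nth_less[OF p, of k j] jk by simp
    with \<open>p ! j = a\<close> \<open>p ! k = b\<close> \<open>a \<le> b\<close> show False by simp
  qed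
  have *: "F b - F a = (\<Sum>i<length p - 1. of_bool (i \<in> {j..<k}) * (F (p ! Suc i) - F (p ! i)))"
    for F :: "real \<Rightarrow> real"
  proof -
    have "(\<Sum>i<length p - 1. of_bool (i \<in> {j..<k}) * (F (p ! Suc i) - F (p ! i)))
        = (\<Sum>i\<in>{j..<k}. F (p ! Suc i) - F (p ! i))"
      using jk by (intro sum.mono_neutral_cong_right) auto
    also have "\<dots> = F b - F a" using sum_Suc_diff'[OF \<open>j \<le> k\<close>, of "\<lambda>i. F (p ! i)"] jk by simp
    finally show ?thesis ..
  qed
  have "(\<Sum>(c, a, b)\<leftarrow>x # xs. c * (F b - F a)) = (\<Sum>i<length p - 1.
      (d i + c * of_bool (i \<in> {j..<k})) * (F (p ! Suc i) - F (p ! i)))" for F :: "real \<Rightarrow> real"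
    by (simp only: x list.map sum_list.Cons case_prod_conv d *[of F] distrib_right sum.distrib
        sum_distrib_left mult.assoc add.commute)
  then show ?case by (intro exI[of _ "\<lambda>i. d i + c * of_bool (i \<in> {j..<k})"] allI)
qed

text \<open>With F a path of W the left-hand side is the step integral; with F = indicator of
  [s, \<open>\<infinity>\<close>) it is the step function at s.\<close>

lemma step_data_grid:
  assumes "valid_step xs"
  shows "\<exists>n \<tau> d. 0 \<le> \<tau> 0 \<and> (\<forall>i<n. \<tau> i < \<tau> (Suc i)) \<and>
    (\<forall>F :: real \<Rightarrow> real. (\<Sum>(c, a, b)\<leftarrow>xs. c * (F b - F a)) =
       (\<Sum>i<n. d i * (F (\<tau> (Suc i)) - F (\<tau> i))))"
proof -
  \<comment> \<open>Inserting 0 keeps the grid nonempty when xs is empty, so that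
    \<open>p ! 0\<close> exists.\<close>
  define P where "P = insert 0 ((\<lambda>(c, a, b). a) ` set xs \<union> (\<lambda>(c, a, b). b) ` set xs)"
  define p where "p = sorted_list_of_set P"
  have P: "finite P" by (simp add: P_def)
  have set_p: "set p = P" by (simp add: p_def P)
  have sp: "sorted_wrt (<) p" by (simp add: p_def strict_sorted_list_of_set)
  have ne: "p \<noteq> []" using set_p by (auto simp: P_def)
  have "p ! 0 \<in> P" using ne set_p by (metis length_greater_0_conv nth_mem)
  then have "0 \<le> p ! 0" using assms by (auto simp: P_def valid_step_def)
  moreover have "\<forall>(c, a, b) \<in> set xs. a \<le> b \<and> a \<in> set p \<and> b \<in> set p"
  proof clarify
    fix c a b assume "(c, a, b) \<in> set xs"
    then show "a \<le> b \<and> a \<in> set p \<and> b \<in> set p"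
      using assms unfolding set_p P_def valid_step_def
      by (auto intro: rev_image_eqI)
  qed
  then obtain d where "\<forall>F :: real \<Rightarrow> real. (\<Sum>(c, a, b)\<leftarrow>xs. c * (F b - F a)) =
           (\<Sum>i<length p - 1. d i * (F (p ! Suc i) - F (p ! i)))"
    using step_data_grid_aux[OF sp] by blast
  moreover have "p ! i < p ! Suc i" if "i < length p - 1" for i
    using sp that by (simp add: sorted_wrt_nth_less)
  ultimately show ?thesis by (intro exI[of _ "length p - 1"] exI[of _ "(!) p"] exI[of _ d]) auto
qed

lemma grid_mono:
  fixes \<tau> :: "nat \<Rightarrow> real"
  assumes "\<And>i. i < n \<Longrightarrow> \<tau> i < \<tau> (Suc i)" "i \<le> j" "j \<le> n"
  shows "\<tau> i \<le> \<tau> j"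
  using assms(2,3)
proof (induction j rule: dec_induct)
  case (step k)
  then show ?case using assms(1)[of k] by linarith
qed simp

lemma step_fun_measurable [measurable]: "step_fun xs \<in> borel_measurable borel"
proof (induction xs)
  case (Cons x xs)
  obtain c a b where "x = (c, a, b)" by (cases x)
  then have "step_fun (x # xs) = (\<lambda>s. c * indicator {a<..b} s + step_fun xs s)"
    by (auto simp: step_fun_def)
  with Cons show ?case by simp
qed (simp add: step_fun_def)

lemma step_integral_measurable:
  assumes "wiener_process M W" "valid_step xs"
  shows "step_integral W xs \<in> borel_measurable M"
  using assms(2)
proof (induction xs)
  case (Cons x xs)
  obtain c a b where x: "x = (c, a, b)" by (cases x)
  then have eq: "step_integral W (x # xs) = (\<lambda>\<omega>. c * (W b \<omega> - W a \<omega>) + step_integral W xs \<omega>)"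
    by (auto simp: step_integral_def)
  have [measurable]: "W a \<in> borel_measurable M" "W b \<in> borel_measurable M"
    using assms Cons.prems by (auto simp: wiener_process_def valid_step_def x)
  have [measurable]: "step_integral W xs \<in> borel_measurable M"
    using Cons by (auto simp: valid_step_def)
  show ?case unfolding eq by measurable
qed (simp add: step_integral_def[abs_def])

lemma step_fun_grid:
  assumes xs: "valid_step xs"
    and \<tau>: "\<And>i. i < n \<Longrightarrow> \<tau> i < \<tau> (Suc i)"
    and F: "\<And>F :: real \<Rightarrow> real. (\<Sum>(c, a, b)\<leftarrow>xs. c * (F b - F a)) =
       (\<Sum>i<n. d i * (F (\<tau> (Suc i)) - F (\<tau> i)))"
  shows "step_fun xs s = (\<Sum>i<n. d i * indicator {\<tau> i<..\<tau> (Suc i)} s)"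
proof -
  have ind: "indicator {a<..b} s = (of_bool (s \<le> b) - of_bool (s \<le> a) :: real)" if "a \<le> b" for a b
    using that by (auto simp: indicator_def)
  have "step_fun xs s = (\<Sum>(c, a, b)\<leftarrow>xs. c * (of_bool (s \<le> b) - of_bool (s \<le> a)))"
    unfolding step_fun_def using xs
    by (intro arg_cong[of _ _ sum_list] map_cong refl) (auto simp: valid_step_def ind)
  also have "\<dots> = (\<Sum>i<n. d i * indicator {\<tau> i<..\<tau> (Suc i)} s)"
    unfolding F using \<tau> by (intro sum.cong refl) (simp add: ind less_imp_le)
  finally show ?thesis .
qed

lemma nn_integral_step_fun_grid:
  assumes "0 \<le> \<tau> 0" and \<tau>: "\<And>i. i < n \<Longrightarrow> \<tau> i < \<tau> (Suc i)"
    and f: "\<And>s. f s = (\<Sum>i<n. d i * indicator {\<tau> i<..\<tau> (Suc i)} s)"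
  shows "(\<integral>\<^sup>+s\<in>{0..}. ennreal ((f s)\<^sup>2) \<partial>lborel) = ennreal (\<Sum>i<n. (d i)\<^sup>2 * (\<tau> (Suc i) - \<tau> i))"
proof -
  \<comment> \<open>At most one cell contains s, so squaring the sum produces no cross
    terms.\<close>
  have sq: "(f s)\<^sup>2 = (\<Sum>i<n. (d i)\<^sup>2 * indicator {\<tau> i<..\<tau> (Suc i)} s)" for s
  proof (cases "\<exists>k<n. s \<in> {\<tau> k<..\<tau> (Suc k)}")
    case False
    then have "\<And>i. i < n \<Longrightarrow> indicator {\<tau> i<..\<tau> (Suc i)} s = (0 :: real)"
      unfolding indicator_def by auto
    then show ?thesis by (simp add: f)
  next
    case True
    then obtain k where k: "k < n" "s \<in> {\<tau> k<..\<tau> (Suc k)}" by auto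
    have ind: "indicator {\<tau> i<..\<tau> (Suc i)} s = (of_bool (i = k) :: real)" if "i < n" for i
    proof (cases i k rule: linorder_cases)
      case less
      then have "\<tau> (Suc i) \<le> \<tau> k" using k by (intro grid_mono[of n \<tau>] \<tau>) auto
      with less k show ?thesis by (auto simp: indicator_def)
    next
      case greater
      then have "\<tau> (Suc k) \<le> \<tau> i" using k that by (intro grid_mono[of n \<tau>] \<tau>) auto
      with greater k show ?thesis by (auto simp: indicator_def)
    qed (use k in auto)
    have "(\<Sum>i<n. e i * indicator {\<tau> i<..\<tau> (Suc i)} s) = e k" for e :: "nat \<Rightarrow> real"
    proof -
      have "(\<Sum>i<n. e i * indicator {\<tau> i<..\<tau> (Suc i)} s) = (\<Sum>i<n. if i = k then e i else 0)"
        by (intro sum.cong) (auto simp: ind)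
      also have "\<dots> = e k" using k by (simp add: sum.delta')
      finally show ?thesis .
    qed
    then show ?thesis by (simp add: f)
  qed
  have "(\<integral>\<^sup>+s\<in>{0..}. ennreal ((f s)\<^sup>2) \<partial>lborel)
      = (\<integral>\<^sup>+s. (\<Sum>i<n. ennreal ((d i)\<^sup>2) * indicator {\<tau> i<..\<tau> (Suc i)} s) \<partial>lborel)"
  proof (intro nn_integral_cong)
    fix s :: real
    have "0 \<le> \<tau> i" if "i < n" for i using grid_mono[of n \<tau> 0 i] \<tau> that assms(1) by force
    then have "s < 0 \<Longrightarrow> i < n \<Longrightarrow> indicator {\<tau> i<..\<tau> (Suc i)} s = (0 :: ennreal)" for i
      by (force simp: indicator_def)
    moreover have "ennreal ((f s)\<^sup>2) = (\<Sum>i<n. ennreal ((d i)\<^sup>2) * indicator {\<tau> i<..\<tau> (Suc i)} s)"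
      unfolding sq by (subst sum_ennreal[symmetric])
        (auto intro!: sum.cong simp: indicator_def)
    ultimately show "ennreal ((f s)\<^sup>2) * indicator {0..} s
        = (\<Sum>i<n. ennreal ((d i)\<^sup>2) * indicator {\<tau> i<..\<tau> (Suc i)} s)"
      by (cases "s < 0") (simp_all add: not_less)
  qed
  also have "\<dots> = (\<Sum>i<n. ennreal ((d i)\<^sup>2) * ennreal (\<tau> (Suc i) - \<tau> i))"
    by (subst nn_integral_sum) (auto intro!: sum.cong simp: nn_integral_cmult_indicator \<tau> less_imp_le)
  also have "\<dots> = ennreal (\<Sum>i<n. (d i)\<^sup>2 * (\<tau> (Suc i) - \<tau> i))"
    by (subst sum_ennreal[symmetric]) (auto intro!: sum.cong simp: ennreal_mult \<tau> less_imp_le)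
  finally show ?thesis .
qed

section \<open>Gaussian law of step integrals\<close>

text \<open>Over disjoint cells the increments of W are independent centred normals, so their
  combination is normal, and its variance is the integral of the squared step function. The case
  \<sigma> = 0 stands apart because a point mass has no density.\<close>

lemma step_integral_distributed:
  assumes W: "wiener_process M W" and xs: "valid_step xs"
  shows "\<exists>\<sigma>\<ge>0. (\<integral>\<^sup>+s\<in>{0..}. ennreal ((step_fun xs s)\<^sup>2) \<partial>lborel) = ennreal (\<sigma>\<^sup>2) \<and>
    (\<sigma> = 0 \<longrightarrow> step_integral W xs = (\<lambda>_. 0)) \<and>
    (\<sigma> > 0 \<longrightarrow> distributed M lborel (step_integral W xs) (\<lambda>x. ennreal (normal_density 0 \<sigma> x)))"
proof -
  interpret prob_space M using W by (simp add: wiener_process_def)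
  obtain n \<tau> d where \<tau>0: "0 \<le> \<tau> 0" and \<tau>: "\<And>i. i < n \<Longrightarrow> \<tau> i < \<tau> (Suc i)"
    and F: "\<And>F :: real \<Rightarrow> real. (\<Sum>(c, a, b)\<leftarrow>xs. c * (F b - F a)) =
       (\<Sum>i<n. d i * (F (\<tau> (Suc i)) - F (\<tau> i)))"
    using step_data_grid[OF xs] by blast
  define v where "v = (\<Sum>i<n. (d i)\<^sup>2 * (\<tau> (Suc i) - \<tau> i))"
  have v0: "0 \<le> v" unfolding v_def using \<tau> by (intro sum_nonneg) (auto simp: less_imp_le)
  have sf: "(\<integral>\<^sup>+s\<in>{0..}. ennreal ((step_fun xs s)\<^sup>2) \<partial>lborel) = ennreal v"
    unfolding v_def by (rule nn_integral_step_fun_grid[where \<tau>=\<tau>, OF \<tau>0 \<tau> step_fun_grid[OF xs \<tau> F]])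
  \<comment> \<open>\<open>sum_indep_normal\<close> wants positive standard deviations and a
    nonempty index set: cells with coefficient 0 are dropped, and an empty I is exactly the case of
    variance 0.\<close>
  define I where "I = {i \<in> {..<n}. d i \<noteq> 0}"
  have si: "step_integral W xs = (\<lambda>\<omega>. \<Sum>i\<in>I. d i * (W (\<tau> (Suc i)) \<omega> - W (\<tau> i) \<omega>))"
  proof
    fix \<omega>
    show "step_integral W xs \<omega> = (\<Sum>i\<in>I. d i * (W (\<tau> (Suc i)) \<omega> - W (\<tau> i) \<omega>))"
      unfolding step_integral_def F[of "\<lambda>t. W t \<omega>"] I_def by (rule sum.mono_neutral_right) auto
  qed
  have vI: "v = (\<Sum>i\<in>I. (d i)\<^sup>2 * (\<tau> (Suc i) - \<tau> i))"
    unfolding v_def I_def by (rule sum.mono_neutral_right) auto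
  have vpos: "I = {}" if "v = 0"
  proof (rule ccontr)
    assume "I \<noteq> {}"
    moreover have "finite I" by (simp add: I_def)
    ultimately have "0 < v" unfolding vI using \<tau> by (intro sum_pos) (auto simp: I_def)
    with that show False by simp
  qed
  show ?thesis
  proof (intro exI[of _ "sqrt v"] conjI impI)
    assume "sqrt v = 0"
    with vpos v0 show "step_integral W xs = (\<lambda>_. 0)" by (simp add: si)
  next
    assume "sqrt v > 0"
    then have I: "I \<noteq> {}" by (auto simp: vI)
    have fin: "finite I" by (simp add: I_def)
    have ti: "0 \<le> \<tau> i" if "i < n" for i using grid_mono[of n \<tau> 0 i] \<tau> that \<tau>0 by force
    have "indep_vars (\<lambda>_. borel) (\<lambda>i \<omega>. W (\<tau> (Suc i)) \<omega> - W (\<tau> i) \<omega>) {..<n}"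
      using W \<tau>0 \<tau> less_imp_le unfolding wiener_process_def by blast
    then have "indep_vars (\<lambda>_. borel) (\<lambda>i \<omega>. W (\<tau> (Suc i)) \<omega> - W (\<tau> i) \<omega>) I"
      by (rule indep_vars_subset) (auto simp: I_def)
    then have ind: "indep_vars (\<lambda>_. borel) (\<lambda>i \<omega>. d i * (W (\<tau> (Suc i)) \<omega> - W (\<tau> i) \<omega>)) I"
      by (rule indep_vars_compose2[where Y = "\<lambda>i x. d i * x"]) simp
    have "distributed M lborel (\<lambda>\<omega>. \<Sum>i\<in>I. d i * (W (\<tau> (Suc i)) \<omega> - W (\<tau> i) \<omega>))
        (normal_density (\<Sum>i\<in>I. 0) (sqrt (\<Sum>i\<in>I. (\<bar>d i\<bar> * sqrt (\<tau> (Suc i) - \<tau> i))\<^sup>2)))"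
    proof (rule sum_indep_normal[OF fin I ind])
      fix i assume i: "i \<in> I"
      then have pos: "0 < sqrt (\<tau> (Suc i) - \<tau> i)" "d i \<noteq> 0" using \<tau> by (auto simp: I_def)
      then show "0 < \<bar>d i\<bar> * sqrt (\<tau> (Suc i) - \<tau> i)" by simp
      have "distributed M lborel (\<lambda>\<omega>. W (\<tau> (Suc i)) \<omega> - W (\<tau> i) \<omega>)
          (\<lambda>x. ennreal (normal_density 0 (sqrt (\<tau> (Suc i) - \<tau> i)) x))"
        using W ti \<tau> i unfolding wiener_process_def I_def by auto
      from normal_density_affine[OF this pos, of 0]
      show "distributed M lborel (\<lambda>\<omega>. d i * (W (\<tau> (Suc i)) \<omega> - W (\<tau> i) \<omega>))
          (normal_density 0 (\<bar>d i\<bar> * sqrt (\<tau> (Suc i) - \<tau> i)))" by simp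
    qed
    moreover have "(\<Sum>i\<in>I. (\<bar>d i\<bar> * sqrt (\<tau> (Suc i) - \<tau> i))\<^sup>2) = v"
      unfolding vI using \<tau> by (intro sum.cong refl) (auto simp: power_mult_distrib I_def less_imp_le)
    ultimately show "distributed M lborel (step_integral W xs) (\<lambda>x. ennreal (normal_density 0 (sqrt v) x))"
      by (simp add: si)
  qed (use v0 sf in auto)
qed

text \<open>Both sides are the variance of the centred normal law found above.\<close>

lemma step_integral_isometry:
  assumes W: "wiener_process M W" and xs: "valid_step xs"
  shows "(\<integral>\<^sup>+\<omega>. ennreal ((step_integral W xs \<omega>)\<^sup>2) \<partial>M) =
         (\<integral>\<^sup>+s\<in>{0..}. ennreal ((step_fun xs s)\<^sup>2) \<partial>lborel)"
proof -
  obtain \<sigma> where \<sigma>: "\<sigma> \<ge> 0"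
    "(\<integral>\<^sup>+s\<in>{0..}. ennreal ((step_fun xs s)\<^sup>2) \<partial>lborel) = ennreal (\<sigma>\<^sup>2)"
    "\<sigma> = 0 \<Longrightarrow> step_integral W xs = (\<lambda>_. 0)"
    "\<sigma> > 0 \<Longrightarrow> distributed M lborel (step_integral W xs) (\<lambda>x. ennreal (normal_density 0 \<sigma> x))"
    using step_integral_distributed[OF W xs] by blast
  show ?thesis
  proof (cases "\<sigma> = 0")
    case True
    with \<sigma> show ?thesis by simp
  next
    case False
    then have pos: "\<sigma> > 0" using \<sigma>(1) by simp
    have "has_bochner_integral lborel (\<lambda>x. normal_density 0 \<sigma> x * x\<^sup>2) (\<sigma>\<^sup>2)"
      using normal_moment_even[OF pos, of 0 1] pos by (simp add: power2_eq_square field_simps)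
    then have "(\<integral>\<^sup>+x. ennreal (normal_density 0 \<sigma> x * x\<^sup>2) \<partial>lborel) = ennreal (\<sigma>\<^sup>2)"
      by (subst nn_integral_eq_integral) (auto simp: has_bochner_integral_iff)
    moreover have "(\<integral>\<^sup>+x. ennreal (normal_density 0 \<sigma> x) * ennreal (x\<^sup>2) \<partial>lborel)
        = (\<integral>\<^sup>+\<omega>. ennreal ((step_integral W xs \<omega>)\<^sup>2) \<partial>M)"
      by (rule distributed_nn_integral[OF \<sigma>(4)[OF pos]]) simp
    ultimately show ?thesis using \<sigma>(2) by (simp add: ennreal_mult)
  qed
qed

text \<open>A centred normal density with standard deviation at least c is bounded by 1 / (2 * c),
  because 2 \<le> sqrt (2 * pi); the interval [-e, e] has length 2 * e.\<close>

lemma step_integral_small_ball: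
  assumes W: "wiener_process M W" and xs: "valid_step xs"
    and c: "0 < c" "ennreal (c\<^sup>2) \<le> (\<integral>\<^sup>+s\<in>{0..}. ennreal ((step_fun xs s)\<^sup>2) \<partial>lborel)"
    and e: "0 \<le> e"
  shows "emeasure M {\<omega> \<in> space M. \<bar>step_integral W xs \<omega>\<bar> \<le> e} \<le> ennreal (e / c)"
proof -
  obtain \<sigma> where \<sigma>: "\<sigma> \<ge> 0"
    "(\<integral>\<^sup>+s\<in>{0..}. ennreal ((step_fun xs s)\<^sup>2) \<partial>lborel) = ennreal (\<sigma>\<^sup>2)"
    "\<sigma> > 0 \<Longrightarrow> distributed M lborel (step_integral W xs) (\<lambda>x. ennreal (normal_density 0 \<sigma> x))"
    using step_integral_distributed[OF W xs] by blast
  have "c\<^sup>2 \<le> \<sigma>\<^sup>2" using c \<sigma>(2) by simp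
  then have "c \<le> \<sigma>" using \<sigma>(1) by (rule power2_le_imp_le)
  then have pos: "\<sigma> > 0" using c by simp
  have dens: "normal_density 0 \<sigma> x \<le> 1 / (2 * c)" for x
  proof -
    have "2 * c \<le> sqrt (2 * pi) * \<sigma>"
      using \<open>c \<le> \<sigma>\<close> c pi_gt3 by (intro mult_mono real_le_rsqrt) auto
    also have "\<dots> = sqrt (2 * pi * \<sigma>\<^sup>2)" using pos by (simp add: real_sqrt_mult)
    finally have "1 / sqrt (2 * pi * \<sigma>\<^sup>2) \<le> 1 / (2 * c)"
      using c(1) pos by (intro divide_left_mono mult_pos_pos) auto
    moreover have "exp (- (x - 0)\<^sup>2 / (2 * \<sigma>\<^sup>2)) \<le> 1" by simp
    ultimately have "1 / sqrt (2 * pi * \<sigma>\<^sup>2) * exp (- (x - 0)\<^sup>2 / (2 * \<sigma>\<^sup>2)) \<le> 1 / (2 * c) * 1"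
      using c(1) by (intro mult_mono) auto
    then show ?thesis by (simp add: normal_density_def)
  qed
  have "{\<omega> \<in> space M. \<bar>step_integral W xs \<omega>\<bar> \<le> e} = step_integral W xs -` {-e..e} \<inter> space M"
    by auto
  then have "emeasure M {\<omega> \<in> space M. \<bar>step_integral W xs \<omega>\<bar> \<le> e}
      = (\<integral>\<^sup>+x. ennreal (normal_density 0 \<sigma> x) * indicator {-e..e} x \<partial>lborel)"
    using distributed_emeasure[OF \<sigma>(3)[OF pos], of "{-e..e}"] by simp
  also have "\<dots> \<le> (\<integral>\<^sup>+x. ennreal (1 / (2 * c)) * indicator {-e..e} x \<partial>lborel)"
    by (intro nn_integral_mono mult_right_mono ennreal_leI dens) auto
  also have "\<dots> = ennreal (1 / (2 * c)) * ennreal (2 * e)"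
    using e by (simp add: nn_integral_cmult_indicator)
  also have "\<dots> = ennreal (e / c)" using c(1) e by (simp add: ennreal_mult[symmetric])
  finally show ?thesis .
qed

section \<open>From step integrals to Wiener integrals\<close>

text \<open>A quadratic substitute for Minkowski's inequality. It holds in the extended reals
  without integrability conditions and costs only the factors 2, which are the source of the
  constants below.\<close>

lemma nn_integral_square_add_le:
  fixes f g :: "'b \<Rightarrow> real"
  assumes [measurable]: "f \<in> borel_measurable N" "g \<in> borel_measurable N"
  shows "(\<integral>\<^sup>+x. ennreal ((f x + g x)\<^sup>2) \<partial>N)
    \<le> 2 * (\<integral>\<^sup>+x. ennreal ((f x)\<^sup>2) \<partial>N) + 2 * (\<integral>\<^sup>+x. ennreal ((g x)\<^sup>2) \<partial>N)"
proof -
  have "(a + b)\<^sup>2 \<le> 2 * a\<^sup>2 + 2 * b\<^sup>2" for a b :: real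
    using sum_squares_bound[of a b] by (simp add: power2_sum)
  then have "(\<integral>\<^sup>+x. ennreal ((f x + g x)\<^sup>2) \<partial>N) \<le> (\<integral>\<^sup>+x. ennreal (2 * (f x)\<^sup>2 + 2 * (g x)\<^sup>2) \<partial>N)"
    by (intro nn_integral_mono ennreal_leI)
  also have "\<dots> = (\<integral>\<^sup>+x. 2 * ennreal ((f x)\<^sup>2) + 2 * ennreal ((g x)\<^sup>2) \<partial>N)"
    by (intro nn_integral_cong) (simp add: ennreal_plus ennreal_mult)
  also have "\<dots> = 2 * (\<integral>\<^sup>+x. ennreal ((f x)\<^sup>2) \<partial>N) + 2 * (\<integral>\<^sup>+x. ennreal ((g x)\<^sup>2) \<partial>N)"
    by (subst nn_integral_add) (auto simp: nn_integral_cmult)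
  finally show ?thesis .
qed

lemma nn_set_integral_restrict_space:
  assumes [measurable]: "f \<in> borel_measurable borel" and A: "A \<in> sets borel"
  shows "(\<integral>\<^sup>+s\<in>A. f s \<partial>lborel) = (\<integral>\<^sup>+s. f s \<partial>restrict_space lborel A)"
  using A by (subst nn_integral_restrict_space) auto

text \<open>Turning the half-line into a measure space gives the two convergences in the definition
  of the Wiener integral the same form, so \<open>nn_integral_square_add_le\<close> applies to
  kernels and to random variables alike.\<close>

abbreviation half_line :: "real measure" where
  "half_line \<equiv> restrict_space lborel {0..}"

lemma has_wiener_integral_half_line:
  "has_wiener_integral M W f Y \<longleftrightarrow> f \<in> borel_measurable borel \<and> Y \<in> borel_measurable M \<and>
     (\<exists>\<phi> :: nat \<Rightarrow> step_data. (\<forall>n. valid_step (\<phi> n)) \<and>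
        (\<lambda>n. \<integral>\<^sup>+s. ennreal ((step_fun (\<phi> n) s - f s)\<^sup>2) \<partial>half_line) \<longlonglongrightarrow> 0 \<and>
        (\<lambda>n. \<integral>\<^sup>+\<omega>. ennreal ((step_integral W (\<phi> n) \<omega> - Y \<omega>)\<^sup>2) \<partial>M) \<longlonglongrightarrow> 0)"
  unfolding has_wiener_integral_def
  by (auto simp: nn_set_integral_restrict_space cong: conj_cong)

lemma half_line_measurable: "f \<in> borel_measurable borel \<Longrightarrow> f \<in> borel_measurable half_line"
  by (simp add: measurable_restrict_space1)

lemma tendsto_zero_ennreal_bound:
  fixes a b c :: "nat \<Rightarrow> ennreal"
  assumes "a \<longlonglongrightarrow> 0" "b \<longlonglongrightarrow> 0" "\<And>n. c n \<le> K * a n + L * b n" "K < top" "L < top"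
  shows "c \<longlonglongrightarrow> 0"
proof (rule tendsto_sandwich[of "\<lambda>_. 0"])
  have "(\<lambda>n. K * a n + L * b n) \<longlonglongrightarrow> K * 0 + L * 0"
    using assms by (intro tendsto_add tendsto_mult_ennreal tendsto_const) auto
  then show "(\<lambda>n. K * a n + L * b n) \<longlonglongrightarrow> 0" by simp
qed (use assms in auto)

text \<open>The intervals of a step list may overlap, so concatenating two approximating lists
  represents the sum exactly, without a common refinement.\<close>

lemma has_wiener_integral_add:
  assumes W: "wiener_process M W" and "has_wiener_integral M W f Y" "has_wiener_integral M W g V"
  shows "has_wiener_integral M W (\<lambda>s. f s + g s) (\<lambda>\<omega>. Y \<omega> + V \<omega>)"
proof -
  from assms obtain \<phi> \<psi> where [measurable]: "f \<in> borel_measurable borel" "Y \<in> borel_measurable M"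
      "g \<in> borel_measurable borel" "V \<in> borel_measurable M"
    and valid: "\<And>n. valid_step (\<phi> n)" "\<And>n. valid_step (\<psi> n)"
    and lim: "(\<lambda>n. \<integral>\<^sup>+s. ennreal ((step_fun (\<phi> n) s - f s)\<^sup>2) \<partial>half_line) \<longlonglongrightarrow> 0"
      "(\<lambda>n. \<integral>\<^sup>+s. ennreal ((step_fun (\<psi> n) s - g s)\<^sup>2) \<partial>half_line) \<longlonglongrightarrow> 0"
      "(\<lambda>n. \<integral>\<^sup>+\<omega>. ennreal ((step_integral W (\<phi> n) \<omega> - Y \<omega>)\<^sup>2) \<partial>M) \<longlonglongrightarrow> 0"
      "(\<lambda>n. \<integral>\<^sup>+\<omega>. ennreal ((step_integral W (\<psi> n) \<omega> - V \<omega>)\<^sup>2) \<partial>M) \<longlonglongrightarrow> 0"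
    unfolding has_wiener_integral_half_line by auto
  note [measurable] = step_integral_measurable[OF W valid(1)] step_integral_measurable[OF W valid(2)]
    half_line_measurable
  have "valid_step (\<phi> n @ \<psi> n)" for n using valid[of n] by (auto simp: valid_step_def)
  moreover have "(\<lambda>n. \<integral>\<^sup>+s. ennreal ((step_fun (\<phi> n @ \<psi> n) s - (f s + g s))\<^sup>2) \<partial>half_line) \<longlonglongrightarrow> 0"
  proof (rule tendsto_zero_ennreal_bound[OF lim(1,2)])
    fix n
    have "step_fun (\<phi> n @ \<psi> n) s - (f s + g s) = (step_fun (\<phi> n) s - f s) + (step_fun (\<psi> n) s - g s)" for s
      by (simp add: step_fun_def)
    then show "(\<integral>\<^sup>+s. ennreal ((step_fun (\<phi> n @ \<psi> n) s - (f s + g s))\<^sup>2) \<partial>half_line)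
      \<le> 2 * (\<integral>\<^sup>+s. ennreal ((step_fun (\<phi> n) s - f s)\<^sup>2) \<partial>half_line) +
        2 * (\<integral>\<^sup>+s. ennreal ((step_fun (\<psi> n) s - g s)\<^sup>2) \<partial>half_line)"
      by (simp only:) (rule nn_integral_square_add_le; measurable)
  qed auto
  moreover have "(\<lambda>n. \<integral>\<^sup>+\<omega>. ennreal ((step_integral W (\<phi> n @ \<psi> n) \<omega> - (Y \<omega> + V \<omega>))\<^sup>2) \<partial>M) \<longlonglongrightarrow> 0"
  proof (rule tendsto_zero_ennreal_bound[OF lim(3,4)])
    fix n
    have "step_integral W (\<phi> n @ \<psi> n) \<omega> - (Y \<omega> + V \<omega>) =
        (step_integral W (\<phi> n) \<omega> - Y \<omega>) + (step_integral W (\<psi> n) \<omega> - V \<omega>)" for \<omega>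
      by (simp add: step_integral_def)
    then show "(\<integral>\<^sup>+\<omega>. ennreal ((step_integral W (\<phi> n @ \<psi> n) \<omega> - (Y \<omega> + V \<omega>))\<^sup>2) \<partial>M)
      \<le> 2 * (\<integral>\<^sup>+\<omega>. ennreal ((step_integral W (\<phi> n) \<omega> - Y \<omega>)\<^sup>2) \<partial>M) +
        2 * (\<integral>\<^sup>+\<omega>. ennreal ((step_integral W (\<psi> n) \<omega> - V \<omega>)\<^sup>2) \<partial>M)"
      by (simp only:) (rule nn_integral_square_add_le; measurable)
  qed auto
  ultimately show ?thesis unfolding has_wiener_integral_half_line by (auto intro!: exI[of _ "\<lambda>n. \<phi> n @ \<psi> n"])
qed

lemma has_wiener_integral_cmult:
  assumes W: "wiener_process M W" and "has_wiener_integral M W f Y"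
  shows "has_wiener_integral M W (\<lambda>s. r * f s) (\<lambda>\<omega>. r * Y \<omega>)"
proof -
  from assms obtain \<phi> where [measurable]: "f \<in> borel_measurable borel" "Y \<in> borel_measurable M"
    and valid: "\<And>n. valid_step (\<phi> n)"
    and lim: "(\<lambda>n. \<integral>\<^sup>+s. ennreal ((step_fun (\<phi> n) s - f s)\<^sup>2) \<partial>half_line) \<longlonglongrightarrow> 0"
      "(\<lambda>n. \<integral>\<^sup>+\<omega>. ennreal ((step_integral W (\<phi> n) \<omega> - Y \<omega>)\<^sup>2) \<partial>M) \<longlonglongrightarrow> 0"
    unfolding has_wiener_integral_half_line by auto
  note [measurable] = step_integral_measurable[OF W valid] half_line_measurable
  define \<psi> where "\<psi> n = map (\<lambda>(c, a, b). (r * c, a, b)) (\<phi> n)" for n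
  have sf: "step_fun (\<psi> n) s = r * step_fun (\<phi> n) s" for n s
    by (auto simp: step_fun_def \<psi>_def sum_list_const_mult[symmetric] o_def
        intro!: arg_cong[of _ _ sum_list])
  have si: "step_integral W (\<psi> n) \<omega> = r * step_integral W (\<phi> n) \<omega>" for n \<omega>
    by (auto simp: step_integral_def \<psi>_def sum_list_const_mult[symmetric] o_def
        intro!: arg_cong[of _ _ sum_list])
  have sq: "ennreal ((r * a - r * b)\<^sup>2) = ennreal (r\<^sup>2) * ennreal ((a - b)\<^sup>2)" for a b
    by (simp add: ennreal_mult[symmetric] power_mult_distrib[symmetric] right_diff_distrib)
  have "valid_step (\<psi> n)" for n using valid[of n] by (auto simp: valid_step_def \<psi>_def)
  moreover have "(\<lambda>n. \<integral>\<^sup>+s. ennreal ((step_fun (\<psi> n) s - r * f s)\<^sup>2) \<partial>half_line) \<longlonglongrightarrow> 0"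
    by (rule tendsto_zero_ennreal_bound[OF lim(1) lim(1), of _ "ennreal (r\<^sup>2)" 0])
      (simp_all add: sf sq nn_integral_cmult)
  moreover have "(\<lambda>n. \<integral>\<^sup>+\<omega>. ennreal ((step_integral W (\<psi> n) \<omega> - r * Y \<omega>)\<^sup>2) \<partial>M) \<longlonglongrightarrow> 0"
    by (rule tendsto_zero_ennreal_bound[OF lim(2) lim(2), of _ "ennreal (r\<^sup>2)" 0])
      (simp_all add: si sq nn_integral_cmult)
  ultimately show ?thesis unfolding has_wiener_integral_half_line by auto
qed

lemma has_wiener_integral_diff:
  assumes W: "wiener_process M W" and "has_wiener_integral M W f Y" "has_wiener_integral M W g V"
  shows "has_wiener_integral M W (\<lambda>s. f s - g s) (\<lambda>\<omega>. Y \<omega> - V \<omega>)"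
  using has_wiener_integral_add[OF W assms(2) has_wiener_integral_cmult[OF W assms(3), of "-1"]]
  by simp

lemma has_wiener_integral_sum:
  assumes W: "wiener_process M W" and "finite I" "\<And>i. i \<in> I \<Longrightarrow> has_wiener_integral M W (f i) (Y i)"
  shows "has_wiener_integral M W (\<lambda>s. \<Sum>i\<in>I. f i s) (\<lambda>\<omega>. \<Sum>i\<in>I. Y i \<omega>)"
  using assms(2,3)
proof (induction I)
  case empty
  show ?case unfolding has_wiener_integral_def
    by (auto intro!: exI[of _ "\<lambda>_. []"] simp: valid_step_def step_fun_def step_integral_def)
next
  case (insert i I)
  then show ?case using has_wiener_integral_add[OF W, of "f i" "Y i"] by simp
qed

text \<open>Y is compared with a step integral and the step function with f; each comparison doubles
  the bound. The exact isometry would give 1 in place of 4, but the growth estimate tolerates any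
  constant.\<close>

lemma has_wiener_integral_second_moment:
  assumes W: "wiener_process M W" and "has_wiener_integral M W f Y"
  shows "(\<integral>\<^sup>+\<omega>. ennreal ((Y \<omega>)\<^sup>2) \<partial>M) \<le> 4 * (\<integral>\<^sup>+s\<in>{0..}. ennreal ((f s)\<^sup>2) \<partial>lborel)"
proof -
  from assms obtain \<phi> where [measurable]: "f \<in> borel_measurable borel" "Y \<in> borel_measurable M"
    and valid: "\<And>n. valid_step (\<phi> n)"
    and lim: "(\<lambda>n. \<integral>\<^sup>+s. ennreal ((step_fun (\<phi> n) s - f s)\<^sup>2) \<partial>half_line) \<longlonglongrightarrow> 0"
      "(\<lambda>n. \<integral>\<^sup>+\<omega>. ennreal ((step_integral W (\<phi> n) \<omega> - Y \<omega>)\<^sup>2) \<partial>M) \<longlonglongrightarrow> 0"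
    unfolding has_wiener_integral_half_line by auto
  note [measurable] = step_integral_measurable[OF W valid] half_line_measurable
  let ?F = "\<integral>\<^sup>+s. ennreal ((f s)\<^sup>2) \<partial>half_line"
  let ?a = "\<lambda>n. \<integral>\<^sup>+s. ennreal ((step_fun (\<phi> n) s - f s)\<^sup>2) \<partial>half_line"
  let ?b = "\<lambda>n. \<integral>\<^sup>+\<omega>. ennreal ((step_integral W (\<phi> n) \<omega> - Y \<omega>)\<^sup>2) \<partial>M"
  have bound: "(\<integral>\<^sup>+\<omega>. ennreal ((Y \<omega>)\<^sup>2) \<partial>M) \<le> 4 * ?F + (4 * ?a n + 2 * ?b n)" for n
  proof -
    have "(\<integral>\<^sup>+\<omega>. ennreal ((Y \<omega>)\<^sup>2) \<partial>M)
        = (\<integral>\<^sup>+\<omega>. ennreal ((step_integral W (\<phi> n) \<omega> + (Y \<omega> - step_integral W (\<phi> n) \<omega>))\<^sup>2) \<partial>M)" by simp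
    also have "\<dots> \<le> 2 * (\<integral>\<^sup>+\<omega>. ennreal ((step_integral W (\<phi> n) \<omega>)\<^sup>2) \<partial>M)
        + 2 * (\<integral>\<^sup>+\<omega>. ennreal ((Y \<omega> - step_integral W (\<phi> n) \<omega>)\<^sup>2) \<partial>M)"
      by (rule nn_integral_square_add_le; measurable)
    also have "(\<integral>\<^sup>+\<omega>. ennreal ((Y \<omega> - step_integral W (\<phi> n) \<omega>)\<^sup>2) \<partial>M) = ?b n"
      by (simp add: power2_commute)
    also have "(\<integral>\<^sup>+\<omega>. ennreal ((step_integral W (\<phi> n) \<omega>)\<^sup>2) \<partial>M)
        = (\<integral>\<^sup>+s. ennreal ((f s + (step_fun (\<phi> n) s - f s))\<^sup>2) \<partial>half_line)"
      by (simp add: step_integral_isometry[OF W valid] nn_set_integral_restrict_space)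
    also have "\<dots> \<le> 2 * ?F + 2 * ?a n"
      by (rule nn_integral_square_add_le; measurable)
    finally show ?thesis by (simp add: distrib_left mult_left_mono add_mono mult.assoc[symmetric] add.assoc)
  qed
  have "(\<lambda>n. 4 * ?F + (4 * ?a n + 2 * ?b n)) \<longlonglongrightarrow> 4 * ?F + (4 * 0 + 2 * 0)"
    by (intro tendsto_add tendsto_mult_ennreal tendsto_const lim) auto
  then have "(\<integral>\<^sup>+\<omega>. ennreal ((Y \<omega>)\<^sup>2) \<partial>M) \<le> 4 * ?F"
    using bound by (intro LIMSEQ_le_const) auto
  then show ?thesis by (simp add: nn_set_integral_restrict_space)
qed

text \<open>If |Y| \<le> e, then an approximating step integral is at most 2 * e in absolute value
  or differs from Y by at least e. The second event is negligible by Markov's inequality; the first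
  is controlled by the normal density with standard deviation at least c / 2. Hence 2 * e / (c / 2)
  = 4 * e / c.\<close>

lemma has_wiener_integral_small_ball:
  assumes W: "wiener_process M W" and "has_wiener_integral M W f Y"
    and c: "0 < c" "ennreal (c\<^sup>2) \<le> (\<integral>\<^sup>+s\<in>{0..}. ennreal ((f s)\<^sup>2) \<partial>lborel)" and e: "0 < e"
  shows "emeasure M {\<omega> \<in> space M. \<bar>Y \<omega>\<bar> \<le> e} \<le> ennreal (4 * e / c)"
proof -
  from assms obtain \<phi> where [measurable]: "f \<in> borel_measurable borel" "Y \<in> borel_measurable M"
    and valid: "\<And>n. valid_step (\<phi> n)"
    and lim: "(\<lambda>n. \<integral>\<^sup>+s. ennreal ((step_fun (\<phi> n) s - f s)\<^sup>2) \<partial>half_line) \<longlonglongrightarrow> 0"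
      "(\<lambda>n. \<integral>\<^sup>+\<omega>. ennreal ((step_integral W (\<phi> n) \<omega> - Y \<omega>)\<^sup>2) \<partial>M) \<longlonglongrightarrow> 0"
    unfolding has_wiener_integral_half_line by auto
  note [measurable] = step_integral_measurable[OF W valid] half_line_measurable
  let ?a = "\<lambda>n. \<integral>\<^sup>+s. ennreal ((step_fun (\<phi> n) s - f s)\<^sup>2) \<partial>half_line"
  let ?b = "\<lambda>n. \<integral>\<^sup>+\<omega>. ennreal ((step_integral W (\<phi> n) \<omega> - Y \<omega>)\<^sup>2) \<partial>M"
  \<comment> \<open>The threshold is chosen so that \<open>c\<^sup>2 \<le> 2 * S + 2 * a\<close>
    leaves \<open>S \<ge> (c / 2)\<^sup>2\<close> for the squared norm S of the step function, a
    being its squared distance to f.\<close>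
  have "\<forall>\<^sub>F n in sequentially. ?a n < ennreal (c\<^sup>2 / 4)"
    using c by (intro order_tendstoD(2)[OF lim(1)]) simp
  moreover have "emeasure M {\<omega> \<in> space M. \<bar>Y \<omega>\<bar> \<le> e} \<le> ennreal (4 * e / c) + ennreal (1 / e\<^sup>2) * ?b n"
    if a: "?a n < ennreal (c\<^sup>2 / 4)" for n
  proof -
    let ?S = "\<integral>\<^sup>+s. ennreal ((step_fun (\<phi> n) s)\<^sup>2) \<partial>half_line"
    have "ennreal (c\<^sup>2) \<le> (\<integral>\<^sup>+s. ennreal ((step_fun (\<phi> n) s + (f s - step_fun (\<phi> n) s))\<^sup>2) \<partial>half_line)"
      using c by (simp add: nn_set_integral_restrict_space)
    also have "\<dots> \<le> 2 * ?S + 2 * (\<integral>\<^sup>+s. ennreal ((f s - step_fun (\<phi> n) s)\<^sup>2) \<partial>half_line)"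
      by (rule nn_integral_square_add_le; measurable)
    also have "(\<integral>\<^sup>+s. ennreal ((f s - step_fun (\<phi> n) s)\<^sup>2) \<partial>half_line) = ?a n"
      by (simp add: power2_commute)
    finally have "ennreal (c\<^sup>2) \<le> 2 * ?S + 2 * ennreal (c\<^sup>2 / 4)"
      using a by (meson add_left_mono less_imp_le mult_left_mono order_trans zero_le)
    then have "ennreal ((c / 2)\<^sup>2) \<le> ?S"
    proof (cases ?S)
      case (real r)
      have "2 * ennreal r + 2 * ennreal q = ennreal (2 * r + 2 * q)" if "0 \<le> q" for q
        using that real by (simp add: ennreal_plus ennreal_mult)
      from this[of "c\<^sup>2 / 4"] have "ennreal (c\<^sup>2) \<le> ennreal (2 * r + 2 * (c\<^sup>2 / 4))"
        using \<open>ennreal (c\<^sup>2) \<le> 2 * ?S + 2 * ennreal (c\<^sup>2 / 4)\<close> real by (simp only:) simp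
      then have "c\<^sup>2 \<le> 2 * r + 2 * (c\<^sup>2 / 4)" using real by (subst (asm) ennreal_le_iff) auto
      then have "(c / 2)\<^sup>2 \<le> r" by (simp add: power_divide)
      then show ?thesis using real by (simp add: ennreal_leI)
    qed simp
    then have small: "emeasure M {\<omega> \<in> space M. \<bar>step_integral W (\<phi> n) \<omega>\<bar> \<le> 2 * e} \<le> ennreal (2 * e / (c / 2))"
      using c(1) e by (intro step_integral_small_ball[OF W valid])
        (auto simp: nn_set_integral_restrict_space)
    have "{\<omega> \<in> space M. \<bar>Y \<omega>\<bar> \<le> e} \<subseteq> {\<omega> \<in> space M. \<bar>step_integral W (\<phi> n) \<omega>\<bar> \<le> 2 * e} \<union>
        {\<omega> \<in> space M. 1 \<le> ennreal (1 / e\<^sup>2) * ennreal ((step_integral W (\<phi> n) \<omega> - Y \<omega>)\<^sup>2)}" (is "_ \<subseteq> ?A \<union> ?B")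
    proof
      fix \<omega> assume \<omega>: "\<omega> \<in> {\<omega> \<in> space M. \<bar>Y \<omega>\<bar> \<le> e}"
      show "\<omega> \<in> ?A \<union> ?B"
      proof (cases "\<bar>step_integral W (\<phi> n) \<omega>\<bar> \<le> 2 * e")
        case False
        with \<omega> e have "e \<le> \<bar>step_integral W (\<phi> n) \<omega> - Y \<omega>\<bar>" by auto
        then have "e\<^sup>2 \<le> (step_integral W (\<phi> n) \<omega> - Y \<omega>)\<^sup>2" using e by (simp add: abs_le_square_iff[symmetric])
        then have "1 \<le> 1 / e\<^sup>2 * (step_integral W (\<phi> n) \<omega> - Y \<omega>)\<^sup>2" using e by (simp add: field_simps)
        then have "1 \<le> ennreal (1 / e\<^sup>2 * (step_integral W (\<phi> n) \<omega> - Y \<omega>)\<^sup>2)" by simp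
        with \<omega> show ?thesis by (simp add: ennreal_mult[symmetric])
      qed (use \<omega> in auto)
    qed
    then have "emeasure M {\<omega> \<in> space M. \<bar>Y \<omega>\<bar> \<le> e} \<le> emeasure M (?A \<union> ?B)"
      by (intro emeasure_mono) measurable
    also have "\<dots> \<le> emeasure M ?A + emeasure M ?B"
      by (intro emeasure_subadditive) measurable
    also have "emeasure M ?B \<le> ennreal (1 / e\<^sup>2) * ?b n"
      using nn_integral_Markov_inequality[of "\<lambda>\<omega>. ennreal ((step_integral W (\<phi> n) \<omega> - Y \<omega>)\<^sup>2)" "space M" M "ennreal (1 / e\<^sup>2)"]
      by (simp cong: nn_integral_cong)
    finally have "emeasure M {\<omega> \<in> space M. \<bar>Y \<omega>\<bar> \<le> e} \<le> emeasure M ?A + ennreal (1 / e\<^sup>2) * ?b n"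
      by (simp add: add_left_mono)
    also have "\<dots> \<le> ennreal (2 * e / (c / 2)) + ennreal (1 / e\<^sup>2) * ?b n"
      by (rule add_right_mono[OF small])
    finally show ?thesis by (simp add: mult.commute)
  qed
  ultimately have "\<forall>\<^sub>F n in sequentially. emeasure M {\<omega> \<in> space M. \<bar>Y \<omega>\<bar> \<le> e} \<le> ennreal (4 * e / c) + ennreal (1 / e\<^sup>2) * ?b n"
    by (auto elim: eventually_mono)
  moreover have "(\<lambda>n. ennreal (4 * e / c) + ennreal (1 / e\<^sup>2) * ?b n) \<longlonglongrightarrow> ennreal (4 * e / c) + ennreal (1 / e\<^sup>2) * 0"
    by (intro tendsto_add tendsto_mult_ennreal tendsto_const lim) auto
  ultimately have "emeasure M {\<omega> \<in> space M. \<bar>Y \<omega>\<bar> \<le> e} \<le> ennreal (4 * e / c) + ennreal (1 / e\<^sup>2) * 0"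
    by (intro tendsto_lowerbound[OF _ _ sequentially_bot])
  then show ?thesis by simp
qed

section \<open>Integrals of powers over short time intervals\<close>

lemma nn_integral_powr_shift:
  fixes g :: real
  assumes "g > -1" "a \<le> b"
  shows "(\<integral>\<^sup>+u\<in>{a..b}. ennreal ((u - a) powr g) \<partial>lborel) = ennreal ((b - a) powr (g + 1) / (g + 1))"
proof -
  have "(\<integral>\<^sup>+u\<in>{a..b}. ennreal ((u - a) powr g) \<partial>lborel)
      = (\<integral>\<^sup>+u. ennreal (u powr g) * indicator {0..b - a} u \<partial>lborel)"
    by (subst nn_integral_real_affine[where c = 1 and t = a]) (auto intro!: nn_integral_cong simp: indicator_def)
  also have "\<dots> = ennreal ((b - a) powr (g + 1) / (g + 1))"
    using assms by (intro nn_integral_has_integral_lebesgue' has_integral_powr_from_0) auto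
  finally show ?thesis .
qed

lemma powr_le_abs_exponent:
  fixes x R :: real
  assumes "1 \<le> x" "x \<le> R"
  shows "x powr b \<le> R powr \<bar>b\<bar>"
proof -
  have "x powr b \<le> x powr \<bar>b\<bar>" using assms by (intro powr_mono) auto
  also have "\<dots> \<le> R powr \<bar>b\<bar>" using assms by (intro powr_mono2) auto
  finally show ?thesis .
qed

text \<open>For g \<ge> 0 the integrand is at most R powr g, which gives a full power of the length.
  For g < 0 the singularity u = s may lie in the interval, and only the power g + 1 remains. What
  matters is that the bound is uniform in s.\<close>

lemma nn_integral_powr_increment_le:
  fixes g :: real
  assumes g: "g > -1" and t: "1 \<le> t" "t \<le> t'" "t' \<le> R" and s: "0 < s"
  shows "(\<integral>\<^sup>+u. ennreal ((u - s) powr g) * indicator {t..t'} u * indicator {s<..} u \<partial>lborel)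
     \<le> ennreal ((1 + 1 / (g + 1)) * R powr \<bar>g\<bar> * (t' - t) powr (min 1 (g + 1)))"
proof (cases "g \<ge> 0")
  case True
  have "(\<integral>\<^sup>+u. ennreal ((u - s) powr g) * indicator {t..t'} u * indicator {s<..} u \<partial>lborel)
      \<le> (\<integral>\<^sup>+u. ennreal (R powr g) * indicator {t..t'} u \<partial>lborel)"
    using t s True
    by (intro nn_integral_mono) (auto simp: indicator_def intro!: ennreal_leI powr_mono2)
  also have "\<dots> = ennreal (R powr g * (t' - t))"
    using t by (simp add: nn_integral_cmult_indicator ennreal_mult)
  also have "\<dots> \<le> ennreal ((1 + 1 / (g + 1)) * R powr \<bar>g\<bar> * (t' - t) powr (min 1 (g + 1)))"
  proof (rule ennreal_leI)
    have "1 * (R powr g * (t' - t)) \<le> (1 + 1 / (g + 1)) * (R powr g * (t' - t))"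
      using True t by (intro mult_right_mono) auto
    then show "R powr g * (t' - t) \<le> (1 + 1 / (g + 1)) * R powr \<bar>g\<bar> * (t' - t) powr (min 1 (g + 1))"
      using True t by (simp add: min_def mult.assoc)
  qed
  finally show ?thesis .
next
  case False
  \<comment> \<open>m is where the integration really begins. As g < 0, moving the singularity from
    s up to m can only increase the integrand. The upper limit \<open>max m t'\<close> covers an
    empty range.\<close>
  define m where "m = max s t"
  have "(\<integral>\<^sup>+u. ennreal ((u - s) powr g) * indicator {t..t'} u * indicator {s<..} u \<partial>lborel)
      \<le> (\<integral>\<^sup>+u\<in>{m..max m t'}. ennreal ((u - m) powr g) \<partial>lborel)"
  proof (rule nn_integral_mono_AE)
    show "AE u in lborel. ennreal ((u - s) powr g) * indicator {t..t'} u * indicator {s<..} u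
      \<le> ennreal ((u - m) powr g) * indicator {m..max m t'} u"
      \<comment> \<open>The point u = m is excluded because \<open>0 powr g\<close> is 0, which
        would break the comparison there.\<close>
      using AE_lborel_singleton[of m]
    proof eventually_elim
      case (elim u)
      show ?case
      proof (cases "t \<le> u \<and> u \<le> t' \<and> s < u")
        case True
        then have "(u - s) powr g \<le> (u - m) powr g"
          using elim False by (intro powr_mono2') (auto simp: m_def max_def)
        with True show ?thesis by (auto simp: indicator_def m_def intro: ennreal_leI)
      qed (auto simp: indicator_def)
    qed
  qed
  also have "\<dots> = ennreal ((max m t' - m) powr (g + 1) / (g + 1))"
    by (rule nn_integral_powr_shift[OF g]) simp
  also have "\<dots> \<le> ennreal ((1 + 1 / (g + 1)) * R powr \<bar>g\<bar> * (t' - t) powr (min 1 (g + 1)))"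
  proof (rule ennreal_leI)
    have "(max m t' - m) powr (g + 1) \<le> (t' - t) powr (g + 1)"
      using t g by (intro powr_mono2) (auto simp: m_def)
    then have "1 / (g + 1) * (max m t' - m) powr (g + 1) \<le> (1 + 1 / (g + 1)) * (t' - t) powr (g + 1)"
      using g by (intro mult_mono) auto
    also have "\<dots> = (1 + 1 / (g + 1)) * 1 * (t' - t) powr (g + 1)" by simp
    also have "\<dots> \<le> (1 + 1 / (g + 1)) * R powr \<bar>g\<bar> * (t' - t) powr (g + 1)"
      using g t by (intro mult_right_mono mult_left_mono) (auto intro: ge_one_powr_ge_zero)
    finally show "(max m t' - m) powr (g + 1) / (g + 1)
        \<le> (1 + 1 / (g + 1)) * R powr \<bar>g\<bar> * (t' - t) powr (min 1 (g + 1))"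
      using False by (simp add: min_def)
  qed
  finally show ?thesis .
qed

lemma nn_integral_Beta_scaled:
  fixes a g u :: real
  assumes "a > -1" "g > -1" "u > 0"
  shows "(\<integral>\<^sup>+s\<in>{0..u}. ennreal (s powr a * (u - s) powr g) \<partial>lborel)
    = ennreal (u powr (a + g + 1) * Beta (a + 1) (g + 1))"
proof -
  have B: "(\<integral>\<^sup>+x. ennreal (x powr a * (1 - x) powr g) * indicator {0..1} x \<partial>lborel) = ennreal (Beta (a + 1) (g + 1))"
    using assms has_integral_Beta_real[of "a + 1" "g + 1"]
    by (intro nn_integral_has_integral_lebesgue') auto
  have B0: "0 \<le> Beta (a + 1) (g + 1)"
    using assms by (simp add: Beta_def Gamma_real_pos less_imp_le)
  have "(\<integral>\<^sup>+s\<in>{0..u}. ennreal (s powr a * (u - s) powr g) \<partial>lborel)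
      = ennreal u * (\<integral>\<^sup>+x. ennreal ((u * x) powr a * (u - u * x) powr g) * indicator {0..u} (u * x) \<partial>lborel)"
    using assms by (subst nn_integral_real_affine[where c = u and t = 0]) auto
  also have "(\<integral>\<^sup>+x. ennreal ((u * x) powr a * (u - u * x) powr g) * indicator {0..u} (u * x) \<partial>lborel)
      = (\<integral>\<^sup>+x. ennreal (u powr (a + g)) * (ennreal (x powr a * (1 - x) powr g) * indicator {0..1} x) \<partial>lborel)"
  proof (intro nn_integral_cong)
    fix x :: real
    show "ennreal ((u * x) powr a * (u - u * x) powr g) * indicator {0..u} (u * x)
      = ennreal (u powr (a + g)) * (ennreal (x powr a * (1 - x) powr g) * indicator {0..1} x)"
    proof (cases "x \<in> {0..1}")
      case True
      then have x: "0 \<le> x" "0 \<le> 1 - x" by auto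
      have "(u - u * x) powr g = u powr g * (1 - x) powr g"
        using x assms by (subst powr_mult[symmetric]) (auto simp: right_diff_distrib)
      then have "(u * x) powr a * (u - u * x) powr g = u powr (a + g) * (x powr a * (1 - x) powr g)"
        using x assms by (simp add: powr_mult powr_add mult_ac)
      then show ?thesis using True assms by (simp add: ennreal_mult mult_le_cancel_left1)
    next
      case False
      then show ?thesis using assms by (auto simp: indicator_def mult_le_cancel_left1 zero_le_mult_iff)
    qed
  qed
  also have "\<dots> = ennreal (u powr (a + g)) * ennreal (Beta (a + 1) (g + 1))"
    by (subst nn_integral_cmult) (auto simp: B)
  also have "ennreal u * \<dots> = ennreal (u powr (a + g + 1) * Beta (a + 1) (g + 1))"
    using assms B0 by (simp add: ennreal_mult[symmetric] powr_add mult_ac)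
  finally show ?thesis .
qed

text \<open>Integrating over s first turns the inner integral into a Beta function times a power of
  u, bounded for u between 1 and R. The remaining integral over u yields a full factor t' - t, even
  where the uniform bound in s gives only a fractional power.\<close>

lemma nn_integral_powr_increment_weighted_le:
  fixes a g :: real
  assumes a: "a > -1" and g: "g > -1" and t: "1 \<le> t" "t \<le> t'" "t' \<le> R"
  shows "(\<integral>\<^sup>+s. ennreal (s powr a) * indicator {0<..} s *
       (\<integral>\<^sup>+u. ennreal ((u - s) powr g) * indicator {t..t'} u * indicator {s<..} u \<partial>lborel) \<partial>lborel)
     \<le> ennreal (Beta (a + 1) (g + 1) * R powr \<bar>a + g + 1\<bar> * (t' - t))"
proof -
  have B0: "0 \<le> Beta (a + 1) (g + 1)"
    using a g by (simp add: Beta_def Gamma_real_pos less_imp_le)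
  \<comment> \<open>Writing \<open>indicator {s<..} u\<close> as a conditional on s < u exhibits
    joint measurability in (s, u), which Fubini's theorem requires.\<close>
  have "(\<integral>\<^sup>+s. ennreal (s powr a) * indicator {0<..} s *
       (\<integral>\<^sup>+u. ennreal ((u - s) powr g) * indicator {t..t'} u * indicator {s<..} u \<partial>lborel) \<partial>lborel)
     = (\<integral>\<^sup>+s. (\<integral>\<^sup>+u. ennreal (s powr a) * indicator {0<..} s * (ennreal ((u - s) powr g) *
          indicator {t..t'} u * (if s < u then 1 else 0)) \<partial>lborel) \<partial>lborel)"
    by (subst nn_integral_cmult[symmetric]) (auto intro!: nn_integral_cong simp: indicator_def)
  also have "\<dots> = (\<integral>\<^sup>+u. (\<integral>\<^sup>+s. ennreal (s powr a) * indicator {0<..} s * (ennreal ((u - s) powr g) *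
          indicator {t..t'} u * (if s < u then 1 else 0)) \<partial>lborel) \<partial>lborel)"
    by (rule lborel_pair.Fubini') measurable
  also have "\<dots> \<le> (\<integral>\<^sup>+u. ennreal (Beta (a + 1) (g + 1) * R powr \<bar>a + g + 1\<bar>) * indicator {t..t'} u \<partial>lborel)"
  proof (rule nn_integral_mono)
    fix u :: real
    show "(\<integral>\<^sup>+s. ennreal (s powr a) * indicator {0<..} s * (ennreal ((u - s) powr g) *
          indicator {t..t'} u * (if s < u then 1 else 0)) \<partial>lborel)
      \<le> ennreal (Beta (a + 1) (g + 1) * R powr \<bar>a + g + 1\<bar>) * indicator {t..t'} u"
    proof (cases "u \<in> {t..t'}")
      case True
      have "(\<integral>\<^sup>+s. ennreal (s powr a) * indicator {0<..} s * (ennreal ((u - s) powr g) *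
          indicator {t..t'} u * (if s < u then 1 else 0)) \<partial>lborel)
        \<le> (\<integral>\<^sup>+s\<in>{0..u}. ennreal (s powr a * (u - s) powr g) \<partial>lborel)"
        by (intro nn_integral_mono) (auto simp: indicator_def ennreal_mult)
      also have "\<dots> = ennreal (u powr (a + g + 1) * Beta (a + 1) (g + 1))"
        using True t by (intro nn_integral_Beta_scaled a g) auto
      also have "\<dots> \<le> ennreal (R powr \<bar>a + g + 1\<bar> * Beta (a + 1) (g + 1))"
        using True t B0 by (intro ennreal_leI mult_right_mono powr_le_abs_exponent) auto
      finally show ?thesis using True by (simp add: mult.commute)
    qed simp
  qed
  also have "\<dots> = ennreal (Beta (a + 1) (g + 1) * R powr \<bar>a + g + 1\<bar> * (t' - t))"
    using t B0 by (simp add: nn_integral_cmult_indicator ennreal_mult)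
  finally show ?thesis .
qed

section \<open>The Volterra kernel: monotonicity, positivity, increments\<close>

text \<open>With nonnegative extended integrals, ranges of integration can be compared and split
  without integrability conditions. The formula also covers t \<le> s, where both sides vanish; for
  t = s this uses \<open>0 powr \<gamma> = 0\<close>.\<close>

lemma gaussian_kernel_eq_enn2real:
  assumes "0 < s"
  shows "gaussian_kernel \<alpha> \<beta> \<gamma> t s =
    s powr \<alpha> * enn2real (\<integral>\<^sup>+u\<in>{s..t}. ennreal (u powr \<beta> * (u - s) powr \<gamma>) \<partial>lborel)"
proof (cases "s < t")
  case True
  have "(LBINT u:{s..t}. u powr \<beta> * (u - s) powr \<gamma>) =
      enn2real (\<integral>\<^sup>+u. ennreal (indicator {s..t} u *\<^sub>R (u powr \<beta> * (u - s) powr \<gamma>)) \<partial>lborel)"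
    unfolding set_lebesgue_integral_def by (rule integral_eq_nn_integral) auto
  also have "(\<integral>\<^sup>+u. ennreal (indicator {s..t} u *\<^sub>R (u powr \<beta> * (u - s) powr \<gamma>)) \<partial>lborel)
      = (\<integral>\<^sup>+u\<in>{s..t}. ennreal (u powr \<beta> * (u - s) powr \<gamma>) \<partial>lborel)"
    by (intro nn_integral_cong) (auto simp: indicator_def)
  finally show ?thesis using True assms by (simp add: gaussian_kernel_def)
next
  case False
  have "(\<integral>\<^sup>+u\<in>{s..t}. ennreal (u powr \<beta> * (u - s) powr \<gamma>) \<partial>lborel) = (\<integral>\<^sup>+u. 0 \<partial>(lborel :: real measure))"
    using False by (intro nn_integral_cong) (auto simp: indicator_def)
  then show ?thesis using False by (simp add: gaussian_kernel_def)
qed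

text \<open>Away from 0 the factor u powr \<beta> is bounded, and the singularity at u = s is
  integrable. Finiteness matters because \<open>enn2real\<close> sends \<open>top\<close> to 0:
  monotonicity and positivity of the kernel both rest on it.\<close>

lemma kernel_integral_finite:
  fixes s t \<beta> \<gamma> :: real
  assumes g: "\<gamma> > -1" and s: "0 < s"
  shows "(\<integral>\<^sup>+u\<in>{s..t}. ennreal (u powr \<beta> * (u - s) powr \<gamma>) \<partial>lborel) < top"
proof (cases "s \<le> t")
  case True
  define c where "c = max (s powr \<beta>) (t powr \<beta>)"
  have c0: "0 \<le> c" by (auto simp: c_def le_max_iff_disj)
  have "u powr \<beta> \<le> c" if "s \<le> u" "u \<le> t" for u
  proof (cases "\<beta> \<ge> 0")
    case True
    with that s have "u powr \<beta> \<le> t powr \<beta>" by (intro powr_mono2) auto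
    then show ?thesis by (simp add: c_def)
  next
    case False
    with that s have "u powr \<beta> \<le> s powr \<beta>" by (intro powr_mono2') auto
    then show ?thesis by (simp add: c_def)
  qed
  then have "(\<integral>\<^sup>+u\<in>{s..t}. ennreal (u powr \<beta> * (u - s) powr \<gamma>) \<partial>lborel)
      \<le> (\<integral>\<^sup>+u. ennreal c * (ennreal ((u - s) powr \<gamma>) * indicator {s..t} u) \<partial>lborel)"
    using c0 by (intro nn_integral_mono)
      (auto simp: indicator_def ennreal_mult[symmetric] intro!: ennreal_leI mult_right_mono)
  also have "\<dots> = ennreal c * ennreal ((t - s) powr (\<gamma> + 1) / (\<gamma> + 1))"
    by (subst nn_integral_cmult) (auto simp: nn_integral_powr_shift[OF g True])
  also have "\<dots> < top" by (simp add: ennreal_mult_less_top)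
  finally show ?thesis .
qed simp

lemma gaussian_kernel_nonneg: "0 \<le> gaussian_kernel \<alpha> \<beta> \<gamma> t s"
proof (cases "0 < s")
  case True
  then show ?thesis by (simp add: gaussian_kernel_eq_enn2real)
qed (simp add: gaussian_kernel_def)

lemma gaussian_kernel_mono:
  assumes "\<gamma> > -1" "t \<le> t'"
  shows "gaussian_kernel \<alpha> \<beta> \<gamma> t s \<le> gaussian_kernel \<alpha> \<beta> \<gamma> t' s"
proof (cases "0 < s")
  case True
  have "(\<integral>\<^sup>+u\<in>{s..t}. ennreal (u powr \<beta> * (u - s) powr \<gamma>) \<partial>lborel)
      \<le> (\<integral>\<^sup>+u\<in>{s..t'}. ennreal (u powr \<beta> * (u - s) powr \<gamma>) \<partial>lborel)"
    using assms by (intro nn_integral_mono mult_left_mono) (auto simp: indicator_def)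
  with True show ?thesis
    by (simp add: gaussian_kernel_eq_enn2real)
      (intro mult_left_mono enn2real_mono kernel_integral_finite assms; simp)
qed (simp add: gaussian_kernel_def)

lemma gaussian_kernel_pos:
  assumes "\<gamma> > -1" "0 < s" "s < t"
  shows "0 < gaussian_kernel \<alpha> \<beta> \<gamma> t s"
proof -
  let ?J = "\<integral>\<^sup>+u\<in>{s..t}. ennreal (u powr \<beta> * (u - s) powr \<gamma>) \<partial>lborel"
  have "?J \<noteq> 0"
  proof
    assume "?J = 0"
    then have "AE u in lborel. ennreal (u powr \<beta> * (u - s) powr \<gamma>) * indicator {s..t} u = 0"
      by (subst (asm) nn_integral_0_iff_AE) auto
    then have "AE u in lborel. u \<notin> {s<..<t}"
      using assms by (auto elim!: eventually_mono simp: indicator_def)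
    then have "emeasure lborel {s<..<t} = 0"
      by (subst (asm) AE_iff_measurable[of "{s<..<t}"]) auto
    with assms show False by simp
  qed
  moreover have "?J < top" by (intro kernel_integral_finite assms)
  ultimately have "0 < enn2real ?J" by (simp add: enn2real_positive_iff zero_less_iff_neq_zero)
  with assms show ?thesis by (simp add: gaussian_kernel_eq_enn2real)
qed

text \<open>The increment comes from u in [t, t'], where u \<ge> 1 bounds u powr \<beta> by a power
  of R. The point s may lie before, inside or after this interval, whence the factor
  \<open>indicator {s<..} u\<close>.\<close>

lemma gaussian_kernel_increment_le:
  assumes g: "\<gamma> > -1" and t: "1 \<le> t" "t \<le> t'" "t' \<le> R" and s: "0 < s"
  defines "G \<equiv> \<integral>\<^sup>+u. ennreal ((u - s) powr \<gamma>) * indicator {t..t'} u * indicator {s<..} u \<partial>lborel"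
  shows "gaussian_kernel \<alpha> \<beta> \<gamma> t' s - gaussian_kernel \<alpha> \<beta> \<gamma> t s \<le> s powr \<alpha> * R powr \<bar>\<beta>\<bar> * enn2real G"
proof -
  let ?J = "\<lambda>t. \<integral>\<^sup>+u\<in>{s..t}. ennreal (u powr \<beta> * (u - s) powr \<gamma>) \<partial>lborel"
  have G: "G < top"
    using nn_integral_powr_increment_le[OF g t s] unfolding G_def by (simp add: le_less_trans)
  have "?J t' \<le> (\<integral>\<^sup>+u. ennreal (u powr \<beta> * (u - s) powr \<gamma>) * indicator {s..t} u +
      ennreal (R powr \<bar>\<beta>\<bar>) * (ennreal ((u - s) powr \<gamma>) * indicator {t..t'} u * indicator {s<..} u) \<partial>lborel)"
  proof (rule nn_integral_mono)
    fix u :: real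
    have *: "ennreal (u powr \<beta> * (u - s) powr \<gamma>) \<le> ennreal (R powr \<bar>\<beta>\<bar>) * ennreal ((u - s) powr \<gamma>)"
      if "t \<le> u" "u \<le> t'"
      using powr_le_abs_exponent[of u R \<beta>] that t
      by (simp add: ennreal_mult[symmetric] ennreal_leI mult_right_mono)
    show "ennreal (u powr \<beta> * (u - s) powr \<gamma>) * indicator {s..t'} u \<le>
      ennreal (u powr \<beta> * (u - s) powr \<gamma>) * indicator {s..t} u +
      ennreal (R powr \<bar>\<beta>\<bar>) * (ennreal ((u - s) powr \<gamma>) * indicator {t..t'} u * indicator {s<..} u)"
    proof (cases "s < u \<and> t < u \<and> u \<le> t'")
      case True
      then show ?thesis using * by (simp add: indicator_def)
    next
      case False
      then show ?thesis using s by (cases "u = s") (auto simp: indicator_def)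
    qed
  qed
  also have "\<dots> = ?J t + ennreal (R powr \<bar>\<beta>\<bar>) * G"
    unfolding G_def by (subst nn_integral_add) (auto simp: nn_integral_cmult)
  finally have "enn2real (?J t') \<le> enn2real (?J t + ennreal (R powr \<bar>\<beta>\<bar>) * G)"
    using G kernel_integral_finite[OF g s] by (intro enn2real_mono) (auto simp: ennreal_mult_less_top)
  also have "\<dots> = enn2real (?J t) + R powr \<bar>\<beta>\<bar> * enn2real G"
    using G kernel_integral_finite[OF g s, where t=t and \<beta>=\<beta>]
    by (subst enn2real_plus) (auto simp: ennreal_mult_less_top enn2real_mult)
  finally have "s powr \<alpha> * enn2real (?J t') \<le> s powr \<alpha> * (enn2real (?J t) + R powr \<bar>\<beta>\<bar> * enn2real G)"
    by (intro mult_left_mono) auto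
  then show ?thesis by (simp add: gaussian_kernel_eq_enn2real[OF s] algebra_simps)
qed

lemma gaussian_kernel_increment_L2:
  assumes a: "\<alpha> > -1 / 2" and g: "\<gamma> > -1"
  obtains A p where "0 \<le> A" and "\<And>t t' R. 1 \<le> t \<Longrightarrow> t \<le> t' \<Longrightarrow> t' \<le> R \<Longrightarrow>
    (\<integral>\<^sup>+s\<in>{0..}. ennreal ((gaussian_kernel \<alpha> \<beta> \<gamma> t' s - gaussian_kernel \<alpha> \<beta> \<gamma> t s)\<^sup>2) \<partial>lborel)
      \<le> ennreal (A * R powr p * (t' - t) powr (1 + min 1 (\<gamma> + 1)))"
proof
  let ?B = "Beta (2 * \<alpha> + 1) (\<gamma> + 1)"
  let ?A = "(1 + 1 / (\<gamma> + 1)) * ?B" and ?p = "2 * \<bar>\<beta>\<bar> + \<bar>\<gamma>\<bar> + \<bar>2 * \<alpha> + \<gamma> + 1\<bar>"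
  have B0: "0 \<le> ?B" using a g by (simp add: Beta_def Gamma_real_pos less_imp_le)
  then show "0 \<le> ?A" using g by simp
  fix t t' R :: real assume t: "1 \<le> t" "t \<le> t'" "t' \<le> R"
  \<comment> \<open>In the square of the increment one factor G is bounded uniformly by C, of order
    h to the power min 1 (\<gamma> + 1); the other one, integrated against the weight, gives a full factor h.\<close>
  define G where "G s = (\<integral>\<^sup>+u. ennreal ((u - s) powr \<gamma>) * indicator {t..t'} u * indicator {s<..} u \<partial>lborel)" for s
  define C where "C = (1 + 1 / (\<gamma> + 1)) * R powr \<bar>\<gamma>\<bar> * (t' - t) powr (min 1 (\<gamma> + 1))"
  have C0: "0 \<le> C" using g by (simp add: C_def)
  have GC: "G s \<le> ennreal C" if "0 < s" for s
    unfolding G_def C_def by (rule nn_integral_powr_increment_le[OF g t that])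
  \<comment> \<open>As a conditional on s < u the integrand is jointly measurable, hence the
    integral over u is measurable in s.\<close>
  have [measurable]: "G \<in> borel_measurable borel"
  proof -
    have "G = (\<lambda>s. \<integral>\<^sup>+u. ennreal ((u - s) powr \<gamma>) * indicator {t..t'} u * (if s < u then 1 else 0) \<partial>lborel)"
      unfolding G_def by (intro ext nn_integral_cong) (auto simp: indicator_def)
    then show ?thesis by simp
  qed
  let ?D = "\<lambda>s. gaussian_kernel \<alpha> \<beta> \<gamma> t' s - gaussian_kernel \<alpha> \<beta> \<gamma> t s"
  have "(\<integral>\<^sup>+s\<in>{0..}. ennreal ((?D s)\<^sup>2) \<partial>lborel)
      \<le> (\<integral>\<^sup>+s. ennreal (R powr (2 * \<bar>\<beta>\<bar>) * C) * (ennreal (s powr (2 * \<alpha>)) * indicator {0<..} s * G s) \<partial>lborel)"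
  proof (rule nn_integral_mono)
    fix s :: real
    show "ennreal ((?D s)\<^sup>2) * indicator {0..} s
      \<le> ennreal (R powr (2 * \<bar>\<beta>\<bar>) * C) * (ennreal (s powr (2 * \<alpha>)) * indicator {0<..} s * G s)"
    proof (cases "0 < s")
      case True
      obtain r where r: "G s = ennreal r" "0 \<le> r" "r \<le> C"
        using GC[OF True] C0 by (cases "G s") (auto simp: top_unique)
      have "?D s \<le> s powr \<alpha> * R powr \<bar>\<beta>\<bar> * r"
        using gaussian_kernel_increment_le[OF g t True, of \<alpha> \<beta>] r by (simp add: G_def[symmetric])
      moreover have "0 \<le> ?D s" using gaussian_kernel_mono[OF g t(2)] by simp
      ultimately have "(?D s)\<^sup>2 \<le> (s powr \<alpha> * R powr \<bar>\<beta>\<bar> * r)\<^sup>2" by (intro power_mono)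
      also have "\<dots> = s powr (2 * \<alpha>) * R powr (2 * \<bar>\<beta>\<bar>) * (r * r)"
        by (simp add: power2_eq_square powr_add[symmetric] mult_ac)
      also have "\<dots> \<le> s powr (2 * \<alpha>) * R powr (2 * \<bar>\<beta>\<bar>) * (C * r)"
        using r by (intro mult_left_mono mult_right_mono) auto
      finally have "ennreal ((?D s)\<^sup>2) \<le> ennreal (R powr (2 * \<bar>\<beta>\<bar>) * C * (s powr (2 * \<alpha>) * r))"
        by (intro ennreal_leI) (simp add: mult_ac)
      then show ?thesis using True r C0 by (simp add: ennreal_mult)
    qed (auto simp: gaussian_kernel_def indicator_def)
  qed
  also have "\<dots> = ennreal (R powr (2 * \<bar>\<beta>\<bar>) * C) * (\<integral>\<^sup>+s. ennreal (s powr (2 * \<alpha>)) * indicator {0<..} s * G s \<partial>lborel)"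
    by (rule nn_integral_cmult) measurable
  also have "\<dots> \<le> ennreal (R powr (2 * \<bar>\<beta>\<bar>) * C) * ennreal (?B * R powr \<bar>2 * \<alpha> + \<gamma> + 1\<bar> * (t' - t))"
    using nn_integral_powr_increment_weighted_le[of "2 * \<alpha>", OF _ g t] a
    by (intro mult_left_mono) (auto simp: G_def)
  also have "\<dots> = ennreal (?A * R powr ?p * (t' - t) powr (1 + min 1 (\<gamma> + 1)))"
  proof -
    have "(R powr (2 * \<bar>\<beta>\<bar>) * C) * (?B * R powr \<bar>2 * \<alpha> + \<gamma> + 1\<bar> * (t' - t))
        = ?A * R powr ?p * (t' - t) powr (1 + min 1 (\<gamma> + 1))"
      using t by (simp add: C_def powr_add mult_ac)
    moreover have "0 \<le> R powr (2 * \<bar>\<beta>\<bar>) * C" "0 \<le> ?B * R powr \<bar>2 * \<alpha> + \<gamma> + 1\<bar> * (t' - t)"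
      using B0 C0 t by simp_all
    ultimately show ?thesis by (simp only: ennreal_mult[symmetric])
  qed
  finally show "(\<integral>\<^sup>+s\<in>{0..}. ennreal ((?D s)\<^sup>2) \<partial>lborel)
      \<le> ennreal (?A * R powr ?p * (t' - t) powr (1 + min 1 (\<gamma> + 1)))" .
qed

text \<open>The kernel is strictly positive on (0, t), a set of positive measure.\<close>

lemma gaussian_kernel_L2_pos:
  assumes "\<gamma> > -1" and [measurable]: "gaussian_kernel \<alpha> \<beta> \<gamma> t \<in> borel_measurable borel" and "0 < t"
  obtains c where "0 < c" "ennreal (c\<^sup>2) \<le> (\<integral>\<^sup>+s\<in>{0..}. ennreal ((gaussian_kernel \<alpha> \<beta> \<gamma> t s)\<^sup>2) \<partial>lborel)"
proof -
  let ?I = "\<integral>\<^sup>+s\<in>{0..}. ennreal ((gaussian_kernel \<alpha> \<beta> \<gamma> t s)\<^sup>2) \<partial>lborel"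
  have "?I \<noteq> 0"
  proof
    assume "?I = 0"
    then have "AE s in lborel. ennreal ((gaussian_kernel \<alpha> \<beta> \<gamma> t s)\<^sup>2) * indicator {0..} s = 0"
      by (subst (asm) nn_integral_0_iff_AE) auto
    then have "AE s in lborel. s \<notin> {0<..<t}"
    proof eventually_elim
      case (elim s)
      then show ?case using gaussian_kernel_pos[OF assms(1), of s t \<alpha> \<beta>] by (auto simp: indicator_def)
    qed
    then have "emeasure lborel {0<..<t} = 0"
      by (subst (asm) AE_iff_measurable[of "{0<..<t}"]) auto
    with assms show False by simp
  qed
  show thesis
  proof (cases ?I)
    case (real r)
    then have "0 < r" using \<open>?I \<noteq> 0\<close> by (auto simp: less_le)
    then show thesis using real by (intro that[of "sqrt r"]) auto
  next
    \<comment> \<open>Only a lower bound is asked for, so any constant serves here.\<close>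
    case top
    then show thesis by (intro that[of 1]) auto
  qed
qed

section \<open>Dyadic chaining and almost sure growth\<close>

text \<open>A grid point of level k + 1 either belongs to level k (j even) or is the right neighbour
  of such a point (j odd). Reaching it from a therefore costs at most one increment per level, and
  the costs form a geometric series. Continuity carries the bound from dyadic points to all
  t.\<close>

lemma dyadic_chaining:
  fixes f :: "real \<Rightarrow> real"
  assumes cont: "continuous_on {a..a + 1} f" and r: "0 < r" "r < 1"
    and inc: "\<And>k j. j < 2 ^ k \<Longrightarrow> \<bar>f (a + (real j + 1) / 2 ^ k) - f (a + real j / 2 ^ k)\<bar> \<le> B * r ^ k"
    and t: "t \<in> {a..a + 1}"
  shows "\<bar>f t - f a\<bar> \<le> B / (1 - r)"
proof -
  have "0 \<le> B * r ^ 0" using inc[of 0 0] by force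
  then have B: "0 \<le> B" by simp
  have grid: "\<bar>f (a + real j / 2 ^ k) - f a\<bar> \<le> B * (\<Sum>i\<le>k. r ^ i)" if "j \<le> 2 ^ k" for j k
    using that
  proof (induction k arbitrary: j)
    case 0
    then have "j = 0 \<or> j = 1" by auto
    then show ?case using inc[of 0 0] B by auto
  next
    case (Suc k)
    show ?case
    proof (cases "even j")
      case True
      then obtain i where i: "j = 2 * i" by blast
      then have "\<bar>f (a + real j / 2 ^ Suc k) - f a\<bar> \<le> B * (\<Sum>i\<le>k. r ^ i)"
        using Suc.IH[of i] Suc.prems by simp
      also have "\<dots> \<le> B * (\<Sum>i\<le>Suc k. r ^ i)" using B r by (intro mult_left_mono) auto
      finally show ?thesis .
    next
      case False
      then obtain i where i: "j = 2 * i + 1" by (elim oddE)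
      have "real (2 * i) / 2 ^ Suc k = real i / 2 ^ k" by simp
      moreover have "\<bar>f (a + real i / 2 ^ k) - f a\<bar> \<le> B * (\<Sum>i\<le>k. r ^ i)"
        using Suc.IH[of i] Suc.prems i by simp
      moreover have "\<bar>f (a + real j / 2 ^ Suc k) - f (a + real (2 * i) / 2 ^ Suc k)\<bar> \<le> B * r ^ Suc k"
        using inc[of "2 * i" "Suc k"] Suc.prems i by (simp add: add.commute)
      ultimately have "\<bar>f (a + real j / 2 ^ Suc k) - f a\<bar> \<le> B * (\<Sum>i\<le>k. r ^ i) + B * r ^ Suc k"
        by simp
      then show ?thesis by (simp add: distrib_left)
    qed
  qed
  have geo: "B * (\<Sum>i\<le>k. r ^ i) \<le> B / (1 - r)" for k
  proof -
    have "(\<Sum>i\<le>k. r ^ i) \<le> (\<Sum>i. r ^ i)" using r by (intro sum_le_suminf) auto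
    also have "\<dots> = 1 / (1 - r)" using r by (intro suminf_geometric) auto
    finally show ?thesis using B mult_left_mono[of _ "1 / (1 - r)" B] by simp
  qed
  \<comment> \<open>s k is the last point of level k that does not exceed t.\<close>
  define s where "s k = a + real (nat \<lfloor>2 ^ k * (t - a)\<rfloor>) / 2 ^ k" for k
  have fl: "real (nat \<lfloor>2 ^ k * (t - a)\<rfloor>) = of_int \<lfloor>2 ^ k * (t - a)\<rfloor>" for k
    using t by simp
  have lo: "t - (1 / 2) ^ k \<le> s k" and hi: "s k \<le> t" for k
  proof -
    have "2 ^ k * (t - a) - 1 \<le> of_int \<lfloor>2 ^ k * (t - a)\<rfloor>" by linarith
    then have "(2 ^ k * (t - a) - 1) / 2 ^ k \<le> s k - a"
      unfolding s_def fl by (simp add: divide_right_mono)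
    then show "t - (1 / 2) ^ k \<le> s k" by (simp add: diff_divide_distrib power_divide)
    have "of_int \<lfloor>2 ^ k * (t - a)\<rfloor> / 2 ^ k \<le> (2 ^ k * (t - a)) / 2 ^ k"
      by (intro divide_right_mono) auto
    then show "s k \<le> t" unfolding s_def fl by simp
  qed
  have s_in: "s k \<in> {a..a + 1}" for k
  proof -
    have "0 \<le> real i / 2 ^ k" for i by simp
    from this[of "nat \<lfloor>2 ^ k * (t - a)\<rfloor>"] have "a \<le> s k" unfolding s_def by linarith
    then show ?thesis using hi[of k] t by simp
  qed
  have j_le: "nat \<lfloor>2 ^ k * (t - a)\<rfloor> \<le> 2 ^ k" for k
  proof -
    have "2 ^ k * (t - a) \<le> 2 ^ k" using t by (intro mult_left_le) auto
    then have "\<lfloor>2 ^ k * (t - a)\<rfloor> \<le> \<lfloor>2 ^ k :: real\<rfloor>" by (rule floor_mono)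
    also have "\<lfloor>2 ^ k :: real\<rfloor> = 2 ^ k" by (metis floor_numeral_power)
    finally show ?thesis by (simp add: nat_le_iff)
  qed
  have "s \<longlonglongrightarrow> t"
  proof (rule tendsto_sandwich[of "\<lambda>k. t - (1 / 2) ^ k" _ _ "\<lambda>_. t"])
    have "(\<lambda>k. t - (1 / 2) ^ k) \<longlonglongrightarrow> t - 0"
      by (intro tendsto_diff tendsto_const LIMSEQ_power_zero) simp
    then show "(\<lambda>k. t - (1 / 2) ^ k) \<longlonglongrightarrow> t" by simp
  qed (use lo hi in auto)
  then have "(\<lambda>k. f (s k)) \<longlonglongrightarrow> f t"
    using cont t s_in by (intro continuous_on_tendsto_compose[OF cont]) auto
  then have "(\<lambda>k. \<bar>f (s k) - f a\<bar>) \<longlonglongrightarrow> \<bar>f t - f a\<bar>" by (intro tendsto_intros)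
  moreover have "\<bar>f (s k) - f a\<bar> \<le> B / (1 - r)" for k
    unfolding s_def using grid[OF j_le[of k]] geo[of k] by linarith
  ultimately show ?thesis by (intro LIMSEQ_le_const2) auto
qed

text \<open>Chaining bounds the oscillation on [n + 1, n + 2] by a multiple of exp (c * n), and
  these bounds add up to a geometric sum of the same order. On [0, 1], where no increments are
  controlled, f is bounded by compactness.\<close>

lemma exponential_growth_if_dyadic_increments:
  fixes f :: "real \<Rightarrow> real"
  assumes cont: "continuous_on {0..} f" and r: "0 < r" "r < 1" and c: "0 < c"
    and inc: "\<And>n k j. j < 2 ^ k \<Longrightarrow>
      \<bar>f (real (Suc n) + (real j + 1) / 2 ^ k) - f (real (Suc n) + real j / 2 ^ k)\<bar> \<le> B * exp (c * n) * r ^ k"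
  shows "\<exists>C. \<forall>t\<ge>0. \<bar>f t\<bar> \<le> C * exp (c * t)"
proof -
  define D where "D = B / (1 - r)"
  have "0 \<le> B * exp (c * real 0) * r ^ 0" using inc[of 0 0 0] by force
  then have "0 \<le> D" using r by (simp add: D_def)
  have local: "\<bar>f t - f (real (Suc n))\<bar> \<le> D * exp (c * n)" if "t \<in> {real (Suc n)..real (Suc n) + 1}" for n t
    using dyadic_chaining[OF continuous_on_subset[OF cont] r inc that] by (auto simp: D_def)
  \<comment> \<open>K solves K + D = K * exp c, which closes the induction over unit intervals
    exactly.\<close>
  define K where "K = D / (exp c - 1)"
  have c1: "0 < exp c - 1" using c by simp
  then have K0: "0 \<le> K" using \<open>0 \<le> D\<close> by (simp add: K_def)
  have KD: "K + D = K * exp c" using c1 by (simp add: K_def field_simps)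
  have nat: "\<bar>f (real (Suc n))\<bar> \<le> \<bar>f 1\<bar> + K * exp (c * n)" for n
  proof (induction n)
    case (Suc n)
    have "\<bar>f (real (Suc (Suc n)))\<bar> \<le> \<bar>f 1\<bar> + (K + D) * exp (c * n)"
      using Suc local[of "real (Suc (Suc n))" n] by (simp add: distrib_right)
    then show ?case unfolding KD by (simp add: distrib_left exp_add mult_ac)
  qed (use K0 in simp)
  have "compact (f ` {0..1})"
    using cont by (intro compact_continuous_image continuous_on_subset[OF cont]) auto
  then have "bounded (f ` {0..1})" by (rule compact_imp_bounded)
  then obtain b where b: "\<And>t. t \<in> {0..1} \<Longrightarrow> \<bar>f t\<bar> \<le> b"
    unfolding bounded_iff by (metis image_eqI real_norm_def)
  show ?thesis
  proof (intro exI allI impI)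
    fix t :: real assume t: "0 \<le> t"
    have b0: "0 \<le> b" using b[of 0] by simp
    show "\<bar>f t\<bar> \<le> (b + \<bar>f 1\<bar> + K + D) * exp (c * t)"
    proof (cases "t \<le> 1")
      case True
      have "\<bar>f t\<bar> \<le> (b + \<bar>f 1\<bar> + K + D) * 1" using b[of t] True t K0 \<open>0 \<le> D\<close> by simp
      also have "\<dots> \<le> (b + \<bar>f 1\<bar> + K + D) * exp (c * t)"
        using b0 K0 \<open>0 \<le> D\<close> t c by (intro mult_left_mono) auto
      finally show ?thesis .
    next
      case False
      \<comment> \<open>The intervals are numbered from the one beginning at 1; since t > 1, the
        subtraction does not truncate.\<close>
      define n where "n = nat \<lfloor>t\<rfloor> - 1"
      have "1 \<le> \<lfloor>t\<rfloor>" using False by simp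
      then have n: "real (Suc n) = of_int \<lfloor>t\<rfloor>" by (simp add: n_def of_nat_diff)
      then have tn: "t \<in> {real (Suc n)..real (Suc n) + 1}" by simp
      have "\<bar>f t\<bar> \<le> \<bar>f 1\<bar> + (K + D) * exp (c * n)"
        using local[OF tn] nat[of n] by (simp add: distrib_right)
      also have "\<dots> \<le> \<bar>f 1\<bar> * exp (c * t) + (K + D) * exp (c * t)"
      proof (intro add_mono mult_left_mono)
        show "\<bar>f 1\<bar> \<le> \<bar>f 1\<bar> * exp (c * t)" using c t by (simp add: mult_le_cancel_left1)
        show "exp (c * n) \<le> exp (c * t)" using tn c by simp
      qed (use K0 \<open>0 \<le> D\<close> in auto)
      also have "\<dots> \<le> (b + \<bar>f 1\<bar> + K + D) * exp (c * t)"
        using b0 by (simp add: distrib_right)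
      finally show ?thesis .
    qed
  qed
qed

lemma summable_exp_powr:
  fixes c p :: real
  assumes "0 < c"
  shows "summable (\<lambda>n. exp (- c * real n) * (real n + 2) powr p)"
proof (rule summable_comparison_test_bigo)
  show "summable (\<lambda>n. norm (exp (- (c / 2)) ^ n))"
    using assms by (simp add: summable_geometric)
  have "(\<lambda>n. exp (- c * real n) * (real n + 2) powr p) \<in> O(\<lambda>n. exp (- (c / 2) * real n))"
    using assms by real_asymp
  then show "(\<lambda>n. exp (- c * real n) * (real n + 2) powr p) \<in> O(\<lambda>n. exp (- (c / 2)) ^ n)"
    by (simp add: exp_of_nat_mult[symmetric] mult.commute)
qed

text \<open>One random series S of weighted squared increments takes the place of a Borel-Cantelli
  argument. Its expectation is finite, so S is finite almost surely; each term being at most S, all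
  increments are then bounded simultaneously with the random constant sqrt S.\<close>

lemma AE_exponential_growth:
  fixes X :: "real \<Rightarrow> 'a \<Rightarrow> real"
  assumes meas: "\<And>t. 0 \<le> t \<Longrightarrow> X t \<in> borel_measurable M"
    and cont: "AE \<omega> in M. continuous_on {0..} (\<lambda>t. X t \<omega>)"
    and d: "0 < d" and c: "0 < c" and A: "0 \<le> A"
    and mom: "\<And>t t' R. 1 \<le> t \<Longrightarrow> t \<le> t' \<Longrightarrow> t' \<le> R \<Longrightarrow>
      (\<integral>\<^sup>+\<omega>. ennreal ((X t' \<omega> - X t \<omega>)\<^sup>2) \<partial>M) \<le> ennreal (A * R powr p * (t' - t) powr (1 + d))"
  shows "AE \<omega> in M. \<exists>C. \<forall>t\<ge>0. \<bar>X t \<omega>\<bar> \<le> C * exp (c * t)"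
proof -
  define q where "q = 2 powr (- d / 2)"
  have q: "0 < q" "q < 1" using d by (auto simp: q_def powr_less_one)
  define \<Delta> where "\<Delta> n k j \<omega> = X (real (Suc n) + (real j + 1) / 2 ^ k) \<omega> - X (real (Suc n) + real j / 2 ^ k) \<omega>"
    for n k j \<omega>
  have [measurable]: "\<Delta> n k j \<in> borel_measurable M" for n k j
    unfolding \<Delta>_def by (intro borel_measurable_diff meas) auto
  \<comment> \<open>The second moments over level k sum to order \<open>q ^ (2 * k)\<close>; half of that gain is spent on
    the weight, which makes the weighted sum of all squares integrable.\<close>
  define w where "w n k = exp (- 2 * c * real n) / q ^ k" for n k
  have w: "0 < w n k" for n k using q by (simp add: w_def)
  define S where "S \<omega> = (\<Sum>n k. \<Sum>j<2 ^ k. ennreal (w n k * (\<Delta> n k j \<omega>)\<^sup>2))" for \<omega>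
  have [measurable]: "S \<in> borel_measurable M" unfolding S_def by measurable
  \<comment> \<open>The exponential discount in the weight beats the polynomial growth of the
    moments in n, so that a is summable. In the path bound the discount reappears as the factor exp
    (c * n).\<close>
  define a where "a n = exp (- (2 * c) * real n) * (real n + 2) powr p" for n
  have a0: "0 \<le> a n" for n by (simp add: a_def)
  have term_bound: "(\<integral>\<^sup>+\<omega>. ennreal (w n k * (\<Delta> n k j \<omega>)\<^sup>2) \<partial>M) \<le> ennreal (A * a n * (q / 2) ^ k)"
    if "j < 2 ^ k" for n k j
  proof -
    have "real j + 1 \<le> 2 ^ k" using that by (metis Suc_leI of_nat_Suc of_nat_le_iff of_nat_numeral of_nat_power add.commute)
    then have le1: "(real j + 1) / 2 ^ k \<le> 1" by simp
    have h: "(real (Suc n) + (real j + 1) / 2 ^ k) - (real (Suc n) + real j / 2 ^ k) = 1 / 2 ^ k"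
      by (simp add: add_divide_distrib)
    have "(\<integral>\<^sup>+\<omega>. ennreal ((\<Delta> n k j \<omega>)\<^sup>2) \<partial>M) \<le> ennreal (A * (real n + 2) powr p * (1 / 2 ^ k) powr (1 + d))"
      unfolding \<Delta>_def h[symmetric] using le1
      by (intro mom) (auto simp: divide_right_mono)
    \<comment> \<open>Here q * q = 2 powr (- d). Division by \<open>q ^ k\<close> from the weight
      leaves \<open>(q / 2) ^ k\<close>, and the \<open>2 ^ k\<close> terms of level k turn this
      into the summable \<open>q ^ k\<close>.\<close>
    also have "(1 / 2 ^ k) powr (1 + d) = (q * q / 2) ^ k"
    proof -
      have "(1 / 2 ^ k) powr (1 + d) = (2 powr (- real k)) powr (1 + d)"
        by (simp add: powr_minus powr_realpow divide_inverse)
      also have "\<dots> = 2 powr ((- d / 2 + - d / 2 - 1) * real k)"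
        unfolding powr_powr by (rule arg_cong) (simp add: algebra_simps)
      also have "\<dots> = (2 powr (- d / 2 + - d / 2 - 1)) ^ k"
        by (simp add: powr_powr[symmetric] powr_realpow)
      also have "2 powr (- d / 2 + - d / 2 - 1) = q * q / 2"
        unfolding powr_diff powr_add q_def by simp
      finally show ?thesis .
    qed
    finally have *: "(\<integral>\<^sup>+\<omega>. ennreal ((\<Delta> n k j \<omega>)\<^sup>2) \<partial>M) \<le> ennreal (A * (real n + 2) powr p * (q * q / 2) ^ k)" .
    have "(\<integral>\<^sup>+\<omega>. ennreal (w n k * (\<Delta> n k j \<omega>)\<^sup>2) \<partial>M) = ennreal (w n k) * (\<integral>\<^sup>+\<omega>. ennreal ((\<Delta> n k j \<omega>)\<^sup>2) \<partial>M)"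
      using w[of n k] by (subst nn_integral_cmult[symmetric]) (auto simp: ennreal_mult less_imp_le)
    also have "\<dots> \<le> ennreal (w n k) * ennreal (A * (real n + 2) powr p * (q * q / 2) ^ k)"
      by (intro mult_left_mono *) simp
    also have "\<dots> = ennreal (w n k * (A * (real n + 2) powr p * (q * q / 2) ^ k))"
      using w[of n k] A q by (subst ennreal_mult) (auto simp: less_imp_le)
    also have "w n k * (A * (real n + 2) powr p * (q * q / 2) ^ k) = A * a n * (q / 2) ^ k"
      using q by (simp add: w_def a_def power_mult_distrib power_divide field_simps)
    finally show ?thesis .
  qed
  have "(\<integral>\<^sup>+\<omega>. S \<omega> \<partial>M) = (\<Sum>n k. \<Sum>j<2 ^ k. \<integral>\<^sup>+\<omega>. ennreal (w n k * (\<Delta> n k j \<omega>)\<^sup>2) \<partial>M)"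
    unfolding S_def by (simp add: nn_integral_suminf nn_integral_sum)
  also have "\<dots> \<le> (\<Sum>n k. \<Sum>j<(2::nat) ^ k. ennreal (A * a n * (q / 2) ^ k))"
    by (intro suminf_le sum_mono term_bound) auto
  also have "\<dots> = (\<Sum>n k. ennreal (A * a n * q ^ k))"
  proof -
    have "(\<Sum>j<(2::nat) ^ k. ennreal (A * a n * (q / 2) ^ k)) = ennreal (A * a n * q ^ k)" for n k
      using A a0[of n] q by (subst sum_ennreal) (auto simp: power_divide)
    then show ?thesis by simp
  qed
  also have "\<dots> = (\<Sum>n. ennreal (A * a n * (1 / (1 - q))))"
  proof (intro suminf_cong)
    fix n
    have "(\<lambda>k. A * a n * q ^ k) sums (A * a n * (1 / (1 - q)))"
      using q by (intro sums_mult geometric_sums) auto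
    then show "(\<Sum>k. ennreal (A * a n * q ^ k)) = ennreal (A * a n * (1 / (1 - q)))"
      using A a0[of n] q by (intro suminf_ennreal_eq) auto
  qed
  also have "\<dots> < top"
  proof -
    have "summable (\<lambda>n. A * a n * (1 / (1 - q)))"
      unfolding a_def using summable_exp_powr[of "2 * c" p] c
      by (intro summable_mult2 summable_mult) auto
    then show ?thesis using A a0 q by (subst suminf_ennreal2) auto
  qed
  finally have "AE \<omega> in M. S \<omega> \<noteq> \<infinity>" by (intro nn_integral_PInf_AE) auto
  with cont show ?thesis
  proof eventually_elim
    case (elim \<omega>)
    obtain s where s: "S \<omega> = ennreal s" "0 \<le> s" using elim by (cases "S \<omega>") auto
    \<comment> \<open>The weight bounds a squared increment by
      \<open>s * exp (2 * c * n) * q ^ k\<close>; the increment itself therefore decays like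
      \<open>r ^ k\<close>.\<close>
    define r where "r = sqrt q"
    have r: "0 < r" "r < 1" using q by (auto simp: r_def real_sqrt_lt_1_iff)
    have "\<bar>\<Delta> n k j \<omega>\<bar> \<le> sqrt s * exp (c * n) * r ^ k" if "j < 2 ^ k" for n k j
    proof -
      have "ennreal (w n k * (\<Delta> n k j \<omega>)\<^sup>2) \<le> (\<Sum>j<2 ^ k. ennreal (w n k * (\<Delta> n k j \<omega>)\<^sup>2))"
        using that by (intro member_le_sum) auto
      also have "\<dots> \<le> (\<Sum>k. \<Sum>j<2 ^ k. ennreal (w n k * (\<Delta> n k j \<omega>)\<^sup>2))"
        using sum_le_suminf[of "\<lambda>k. \<Sum>j<2 ^ k. ennreal (w n k * (\<Delta> n k j \<omega>)\<^sup>2)" "{k}"] by simp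
      also have "\<dots> \<le> S \<omega>"
        using sum_le_suminf[of "\<lambda>n. \<Sum>k. \<Sum>j<2 ^ k. ennreal (w n k * (\<Delta> n k j \<omega>)\<^sup>2)" "{n}"] by (simp add: S_def)
      finally have "w n k * (\<Delta> n k j \<omega>)\<^sup>2 \<le> s" using s by simp
      then have "(\<Delta> n k j \<omega>)\<^sup>2 \<le> s / w n k" using w[of n k] by (simp add: field_simps)
      also have "\<dots> = (sqrt s * exp (c * n) * r ^ k)\<^sup>2"
      proof -
        have "(r ^ k)\<^sup>2 = q ^ k" using q by (simp add: r_def power_mult[symmetric] mult.commute[of k] power_mult)
        moreover have "exp (- 2 * c * real n) * (exp (c * n))\<^sup>2 = 1"
          by (simp add: power2_eq_square exp_add[symmetric])
        ultimately show ?thesis using s q by (simp add: w_def power_mult_distrib field_simps)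
      qed
      finally show ?thesis using s r by (subst (asm) abs_le_square_iff[symmetric]) simp
    qed
    then show ?case
      using exponential_growth_if_dyadic_increments[where f = "\<lambda>t. X t \<omega>", OF _ r c] elim
      unfolding \<Delta>_def by blast
  qed
qed

section \<open>Pathwise analysis: discounted integrals and the Langevin equation\<close>

lemma riemann_sums_tendsto_integral:
  fixes f :: "real \<Rightarrow> real"
  assumes cont: "continuous_on {0..real n} f"
  shows "(\<lambda>m. \<Sum>i<n * Suc m. f (real i / real (Suc m)) / real (Suc m)) \<longlonglongrightarrow> integral {0..real n} f"
proof (rule LIMSEQ_I)
  fix e :: real assume "0 < e"
  \<comment> \<open>The cells have total length n, so an error rate e' adds up to e' * n. The added
    1 makes this strictly smaller than e and covers n = 0.\<close>
  define e' where "e' = e / (real n + 1)"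
  have e': "0 < e'" using \<open>0 < e\<close> by (simp add: e'_def)
  have "uniformly_continuous_on {0..real n} f"
    using cont by (intro compact_uniformly_continuous) auto
  then obtain d where d: "0 < d"
    "\<And>x y. x \<in> {0..real n} \<Longrightarrow> y \<in> {0..real n} \<Longrightarrow> dist y x < d \<Longrightarrow> dist (f y) (f x) < e'"
    using e' unfolding uniformly_continuous_on_def by metis
  obtain N where N: "inverse (real (Suc N)) < d" using d(1) reals_Archimedean by blast
  show "\<exists>N. \<forall>m\<ge>N. norm ((\<Sum>i<n * Suc m. f (real i / real (Suc m)) / real (Suc m)) - integral {0..real n} f) < e"
  proof (intro exI allI impI)
    fix m assume "N \<le> m"
    define h where "h = 1 / real (Suc m)"
    have h0: "0 < h" by (simp add: h_def)
    have hd: "h < d"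
    proof -
      have "h \<le> inverse (real (Suc N))" using \<open>N \<le> m\<close> by (simp add: h_def field_simps)
      with N show ?thesis by simp
    qed
    have nh: "real (n * Suc m) * h = real n" by (simp add: h_def del: of_nat_Suc mult_Suc_right)
    \<comment> \<open>Through the indefinite integral the whole integral telescopes over the cells,
      and the comparison is reduced to a single cell.\<close>
    define F where "F t = integral {0..t} f" for t
    have step: "\<bar>f (real i * h) * h - (F (real (Suc i) * h) - F (real i * h))\<bar> \<le> e' * h" if "i < n * Suc m" for i
    proof -
      have "real (Suc i) \<le> real (n * Suc m)" using that by linarith
      then have "real (Suc i) * h \<le> real (n * Suc m) * h" using h0 by (intro mult_right_mono) auto
      then have top: "real (Suc i) * h \<le> real n" unfolding nh .
      have bot: "0 \<le> real i * h" using h0 by simp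
      have le: "real i * h \<le> real (Suc i) * h" using h0 by (simp add: distrib_right)
      have sub: "{real i * h..real (Suc i) * h} \<subseteq> {0..real n}" using top bot by auto
      have c1: "continuous_on {real i * h..real (Suc i) * h} f" by (rule continuous_on_subset[OF cont sub])
      have fi: "f integrable_on {0..real (Suc i) * h}"
        using top by (intro integrable_continuous_interval continuous_on_subset[OF cont]) auto
      have "F (real (Suc i) * h) - F (real i * h) = integral {real i * h..real (Suc i) * h} f"
        unfolding F_def using Henstock_Kurzweil_Integration.integral_combine[OF bot le fi] by linarith
      moreover have "integral {real i * h..real (Suc i) * h} (\<lambda>s. f s - f (real i * h))
          = integral {real i * h..real (Suc i) * h} f - integral {real i * h..real (Suc i) * h} (\<lambda>s. f (real i * h))"
        using c1 by (intro Henstock_Kurzweil_Integration.integral_diff integrable_continuous_interval) auto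
      moreover have "integral {real i * h..real (Suc i) * h} (\<lambda>s. f (real i * h)) = f (real i * h) * h"
        using le by (simp add: algebra_simps)
      moreover have "norm (integral {real i * h..real (Suc i) * h} (\<lambda>s. f s - f (real i * h))) \<le> e' * (real (Suc i) * h - real i * h)"
      proof (rule integral_bound[OF le])
        show "continuous_on {real i * h..real (Suc i) * h} (\<lambda>s. f s - f (real i * h))"
          by (intro continuous_intros c1)
        fix s assume s: "s \<in> {real i * h..real (Suc i) * h}"
        then have "dist s (real i * h) < d" using hd by (simp add: dist_real_def distrib_right)
        then show "norm (f s - f (real i * h)) \<le> e'"
          using d(2)[of "real i * h" s] s sub le by (auto simp: dist_real_def)
      qed
      moreover have "e' * (real (Suc i) * h - real i * h) = e' * h" by (simp add: algebra_simps)
      ultimately show ?thesis unfolding real_norm_def by linarith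
    qed
    have "integral {0..real n} f = F (real (n * Suc m) * h) - F (real 0 * h)"
      unfolding nh by (simp add: F_def)
    also have "\<dots> = (\<Sum>i<n * Suc m. F (real (Suc i) * h) - F (real i * h))"
      by (rule sum_lessThan_telescope[symmetric])
    finally have "(\<Sum>i<n * Suc m. f (real i / real (Suc m)) / real (Suc m)) - integral {0..real n} f
      = (\<Sum>i<n * Suc m. f (real i * h) * h - (F (real (Suc i) * h) - F (real i * h)))"
      unfolding sum_subtractf by (simp add: h_def)
    also have "\<bar>\<dots>\<bar> \<le> (\<Sum>i<n * Suc m. e' * h)"
      by (intro order_trans[OF sum_abs] sum_mono step) simp
    also have "\<dots> = e' * real n" using nh by (simp add: mult.left_commute)
    also have "\<dots> < e"
      using \<open>0 < e\<close> by (simp add: e'_def field_simps)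
    finally show "norm ((\<Sum>i<n * Suc m. f (real i / real (Suc m)) / real (Suc m)) - integral {0..real n} f) < e"
      by simp
  qed
qed

text \<open>Half of the discount rate pays for the growth of x. The other half leaves a multiple of
  \<open>exp (- (\<theta> / 2) * s)\<close> as an integrable majorant, so the improper integral
  converges absolutely.\<close>

lemma discounted_integral_converges:
  fixes x :: "real \<Rightarrow> real"
  assumes cont: "continuous_on {0..} x" and \<theta>: "0 < \<theta>"
    and growth: "\<And>t. 0 \<le> t \<Longrightarrow> \<bar>x t\<bar> \<le> C * exp (\<theta> / 2 * t)"
  shows "\<exists>L. ((\<lambda>T. integral {0..T} (\<lambda>s. exp (- \<theta> * s) * x s)) \<longlongrightarrow> L) at_top"
proof -
  have "(\<integral>\<^sup>+s. ennreal (exp (- (\<theta> / 2) * s)) * indicator {0..} s \<partial>lborel) = ennreal (exp (- (\<theta> / 2) * 0) / (\<theta> / 2))"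
    using \<theta> by (intro nn_integral_has_integral_lebesgue' has_integral_exp_minus_to_infinity) auto
  moreover have "(\<integral>\<^sup>+s. ennreal (exp (- (\<theta> / 2) * s)) * indicator {0..} s \<partial>lborel)
      = (\<integral>\<^sup>+s. ennreal (indicator {0..} s *\<^sub>R exp (- (\<theta> / 2) * s)) \<partial>lborel)"
    by (intro nn_integral_cong) (auto simp: indicator_def)
  ultimately have fin: "(\<integral>\<^sup>+s. ennreal (indicator {0..} s *\<^sub>R exp (- (\<theta> / 2) * s)) \<partial>lborel) < \<infinity>"
    by (metis ennreal_less_top infinity_ennreal_def)
  have "set_integrable lborel {0..} (\<lambda>s. exp (- (\<theta> / 2) * s))"
    unfolding set_integrable_def by (rule integrableI_nonneg[OF _ _ fin]) auto
  then have "set_integrable lborel {0..} (\<lambda>s. C * exp (- (\<theta> / 2) * s))"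
    by (rule set_integrable_mult_right)
  then have "set_integrable lborel {0..} (\<lambda>s. exp (- \<theta> * s) * x s)"
  proof (rule set_integrable_bound)
    show "set_borel_measurable lborel {0..} (\<lambda>s. exp (- \<theta> * s) * x s)"
      unfolding set_borel_measurable_def measurable_lborel2
      by (intro borel_measurable_continuous_on_indicator continuous_intros cont) auto
    show "AE s in lborel. s \<in> {0..} \<longrightarrow> norm (exp (- \<theta> * s) * x s) \<le> norm (C * exp (- (\<theta> / 2) * s))"
    proof (intro AE_I2 impI)
      fix s :: real assume "s \<in> {0..}"
      then have "exp (- \<theta> * s) * \<bar>x s\<bar> \<le> exp (- \<theta> * s) * (C * exp (\<theta> / 2 * s))"
        by (intro mult_left_mono growth) auto
      also have "\<dots> = C * (exp (- \<theta> * s) * exp (\<theta> / 2 * s))" by simp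
      also have "exp (- \<theta> * s) * exp (\<theta> / 2 * s) = exp (- (\<theta> / 2) * s)"
        by (simp add: exp_add[symmetric])
      also have "C * exp (- (\<theta> / 2) * s) \<le> \<bar>C\<bar> * exp (- (\<theta> / 2) * s)"
        by (intro mult_right_mono) auto
      finally show "norm (exp (- \<theta> * s) * x s) \<le> norm (C * exp (- (\<theta> / 2) * s))"
        by (simp add: abs_mult)
    qed
  qed
  then have "((\<lambda>T. LBINT s:{0..T}. exp (- \<theta> * s) * x s) \<longlongrightarrow> (LBINT s:{0..}. exp (- \<theta> * s) * x s)) at_top"
    by (intro tendsto_set_lebesgue_integral_at_top) auto
  moreover have "(LBINT s:{0..T}. exp (- \<theta> * s) * x s) = integral {0..T} (\<lambda>s. exp (- \<theta> * s) * x s)" for T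
    by (intro set_borel_integral_eq_integral borel_integrable_atLeastAtMost' continuous_intros
        continuous_on_subset[OF cont]) auto
  ultimately show ?thesis by auto
qed

lemma langevin_path_ratio_tendsto:
  fixes x z :: "real \<Rightarrow> real"
  assumes \<theta>: "0 < \<theta>" and cont: "continuous_on {0..} x"
    and z: "\<And>t. 0 \<le> t \<Longrightarrow> set_integrable lborel {0..t} z \<and> z t = \<theta> * (LBINT s:{0..t}. z s) + x t"
    and growth: "\<And>t. 0 \<le> t \<Longrightarrow> \<bar>x t\<bar> \<le> C * exp (\<theta> / 2 * t)"
    and lim: "((\<lambda>T. integral {0..T} (\<lambda>s. exp (- \<theta> * s) * x s)) \<longlongrightarrow> L) at_top" and L: "L \<noteq> 0"
  shows "((\<lambda>T. (z T)\<^sup>2 / (2 * (LBINT s:{0..T}. (z s)\<^sup>2))) \<longlongrightarrow> \<theta>) at_top"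
proof -
  define I where "I t = integral {0..t} z" for t
  have zint: "z integrable_on {0..t}" if "0 \<le> t" for t
    using z[OF that] set_borel_integral_eq_integral by blast
  have zI: "z t = \<theta> * I t + x t" if "0 \<le> t" for t
    using z[OF that] set_borel_integral_eq_integral(2)[of "{0..t}" z] by (simp add: I_def)
  \<comment> \<open>The solution is assumed only to be integrable. Its integral I is then
    continuous, and the equation passes continuity on to z, which in turn makes I
    differentiable.\<close>
  have contz: "continuous_on {0..T} z" for T
  proof (cases "0 \<le> T")
    case True
    have "continuous_on {0..T} (\<lambda>t. \<theta> * I t + x t)"
      unfolding I_def using zint[OF True]
      by (intro continuous_intros indefinite_integral_continuous_1 continuous_on_subset[OF cont]) auto
    then show ?thesis by (rule continuous_on_eq) (use zI in auto)
  qed simp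
  have I_deriv: "(I has_real_derivative z t) (at t within {0..T})" if "t \<in> {0..T}" for t T
    unfolding I_def by (rule integral_has_real_derivative[OF contz that])
  have V: "exp (- \<theta> * T) * I T = integral {0..T} (\<lambda>s. exp (- \<theta> * s) * x s)" if "0 \<le> T" for T
  proof -
    have "((\<lambda>s. exp (- \<theta> * s) * x s) has_integral (exp (- \<theta> * T) * I T - exp (- \<theta> * 0) * I 0)) {0..T}"
    proof (rule fundamental_theorem_of_calculus[OF that])
      fix t assume t: "t \<in> {0..T}"
      have "((\<lambda>s. exp (- \<theta> * s) * I s) has_real_derivative
          exp (- \<theta> * t) * z t + (exp (- \<theta> * t) * - \<theta>) * I t) (at t within {0..T})"
        by (auto intro!: derivative_eq_intros I_deriv[OF t])
      moreover have "exp (- \<theta> * t) * z t + (exp (- \<theta> * t) * - \<theta>) * I t = exp (- \<theta> * t) * x t"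
        using zI[of t] t by (simp add: algebra_simps)
      ultimately show "((\<lambda>s. exp (- \<theta> * s) * I s) has_vector_derivative exp (- \<theta> * t) * x t) (at t within {0..T})"
        by (simp add: has_real_derivative_iff_has_vector_derivative)
    qed
    then show ?thesis by (simp add: I_def integral_unique)
  qed
  have limV: "((\<lambda>T. exp (- \<theta> * T) * I T) \<longlongrightarrow> L) at_top"
  proof (rule Lim_transform_eventually[OF lim])
    show "\<forall>\<^sub>F T in at_top. integral {0..T} (\<lambda>s. exp (- \<theta> * s) * x s) = exp (- \<theta> * T) * I T"
      using eventually_ge_at_top[of 0] by eventually_elim (rule V[symmetric])
  qed
  have limx: "((\<lambda>T. exp (- \<theta> * T) * x T) \<longlongrightarrow> 0) at_top"
  proof (rule Lim_null_comparison)
    show "\<forall>\<^sub>F T in at_top. norm (exp (- \<theta> * T) * x T) \<le> C * exp (- (\<theta> / 2) * T)"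
      using eventually_ge_at_top[of 0]
    proof eventually_elim
      case (elim T)
      have "exp (- \<theta> * T) * \<bar>x T\<bar> \<le> exp (- \<theta> * T) * (C * exp (\<theta> / 2 * T))"
        using elim by (intro mult_left_mono growth) auto
      also have "\<dots> = C * (exp (- \<theta> * T) * exp (\<theta> / 2 * T))" by simp
      also have "exp (- \<theta> * T) * exp (\<theta> / 2 * T) = exp (- (\<theta> / 2) * T)"
        by (simp add: exp_add[symmetric])
      finally show ?case by (simp add: abs_mult)
    qed
    show "((\<lambda>T. C * exp (- (\<theta> / 2) * T)) \<longlongrightarrow> 0) at_top" using \<theta> by real_asymp
  qed
  have "((\<lambda>T. \<theta> * (exp (- \<theta> * T) * I T) + exp (- \<theta> * T) * x T) \<longlongrightarrow> \<theta> * L + 0) at_top"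
    by (intro tendsto_intros limV limx)
  then have "((\<lambda>T. \<theta> * (exp (- \<theta> * T) * I T) + exp (- \<theta> * T) * x T) \<longlongrightarrow> \<theta> * L) at_top" by simp
  then have limz: "((\<lambda>T. exp (- \<theta> * T) * z T) \<longlongrightarrow> \<theta> * L) at_top"
  proof (rule Lim_transform_eventually)
    show "\<forall>\<^sub>F T in at_top. \<theta> * (exp (- \<theta> * T) * I T) + exp (- \<theta> * T) * x T = exp (- \<theta> * T) * z T"
      using eventually_ge_at_top[of 0] by eventually_elim (simp add: zI algebra_simps)
  qed
  define Q where "Q T = integral {0..T} (\<lambda>s. (z s)\<^sup>2)" for T
  have Q_eq: "(LBINT s:{0..T}. (z s)\<^sup>2) = Q T" for T
    unfolding Q_def by (intro set_borel_integral_eq_integral borel_integrable_atLeastAtMost' continuous_intros contz)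
  have exp_sq: "(exp (- \<theta> * T))\<^sup>2 = 1 / exp (2 * \<theta> * T)" for T
    by (simp add: power2_eq_square exp_add[symmetric] exp_minus[symmetric] divide_inverse)
  \<comment> \<open>l'Hospital's rule is applied to Q against the exponential and not to the
    estimator itself: z need not be differentiable, as x is only continuous. The quotient of
    derivatives tends to (\<theta> * L)^2 / (2 * \<theta>).\<close>
  have limQ: "((\<lambda>T. Q T / exp (2 * \<theta> * T)) \<longlongrightarrow> \<theta> * L\<^sup>2 / 2) at_top"
  proof (rule lhospital_at_top_at_top)
    show "filterlim (\<lambda>T. exp (2 * \<theta> * T)) at_top at_top" using \<theta> by real_asymp
    show "\<forall>\<^sub>F T in at_top. 2 * \<theta> * exp (2 * \<theta> * T) \<noteq> 0" using \<theta> by simp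
    show "\<forall>\<^sub>F T in at_top. ((\<lambda>T. exp (2 * \<theta> * T)) has_real_derivative 2 * \<theta> * exp (2 * \<theta> * T)) (at T)"
      by (auto intro!: always_eventually derivative_eq_intros)
    show "\<forall>\<^sub>F T in at_top. (Q has_real_derivative (z T)\<^sup>2) (at T)"
      using eventually_gt_at_top[of 0]
    proof eventually_elim
      case (elim T)
      have "(Q has_real_derivative (z T)\<^sup>2) (at T within {0..T + 1})"
        unfolding Q_def using elim by (intro integral_has_real_derivative continuous_intros contz) auto
      moreover have "at T within {0..T + 1} = at T" using elim by (intro at_within_Icc_at) auto
      ultimately show ?case by simp
    qed
    have "((\<lambda>T. (exp (- \<theta> * T) * z T)\<^sup>2 / (2 * \<theta>)) \<longlongrightarrow> (\<theta> * L)\<^sup>2 / (2 * \<theta>)) at_top"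
      using \<theta> by (intro tendsto_intros limz) auto
    moreover have "(exp (- \<theta> * T) * z T)\<^sup>2 / (2 * \<theta>) = (z T)\<^sup>2 / (2 * \<theta> * exp (2 * \<theta> * T))" for T
      unfolding power_mult_distrib exp_sq by simp
    moreover have "(\<theta> * L)\<^sup>2 / (2 * \<theta>) = \<theta> * L\<^sup>2 / 2" using \<theta> by (simp add: power2_eq_square)
    ultimately show "((\<lambda>T. (z T)\<^sup>2 / (2 * \<theta> * exp (2 * \<theta> * T))) \<longlongrightarrow> \<theta> * L\<^sup>2 / 2) at_top" by simp
  qed
  have "((\<lambda>T. (exp (- \<theta> * T) * z T)\<^sup>2 / (2 * (Q T / exp (2 * \<theta> * T)))) \<longlongrightarrow> (\<theta> * L)\<^sup>2 / (2 * (\<theta> * L\<^sup>2 / 2))) at_top"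
    using \<theta> L by (intro tendsto_divide tendsto_mult tendsto_power tendsto_const limz limQ) auto
  moreover have "(\<theta> * L)\<^sup>2 / (2 * (\<theta> * L\<^sup>2 / 2)) = \<theta>" using \<theta> L by (simp add: power2_eq_square)
  moreover have "(exp (- \<theta> * T) * z T)\<^sup>2 / (2 * (Q T / exp (2 * \<theta> * T))) = (z T)\<^sup>2 / (2 * (LBINT s:{0..T}. (z s)\<^sup>2))" for T
    unfolding power_mult_distrib exp_sq Q_eq by simp
  ultimately show ?thesis by simp
qed

section \<open>Nondegeneracy of the limit\<close>

text \<open>Where |V| \<le> e, eventually |Y m| < 2 * e; the doubled radius absorbs the
  approximation error, and Fatou's lemma transfers the bound. Hypothesis and conclusion have the
  same form, linear in e, so the lemma can be iterated along successive limits.\<close>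

lemma small_ball_AE_limit:
  fixes Y :: "nat \<Rightarrow> 'a \<Rightarrow> real"
  assumes [measurable]: "\<And>m. Y m \<in> borel_measurable M" "V \<in> borel_measurable M"
    and lim: "AE \<omega> in M. (\<lambda>m. Y m \<omega>) \<longlonglongrightarrow> V \<omega>"
    and bound: "\<And>m e. 0 < e \<Longrightarrow> emeasure M {\<omega> \<in> space M. \<bar>Y m \<omega>\<bar> \<le> e} \<le> ennreal (K * e)"
    and e: "0 < e"
  shows "emeasure M {\<omega> \<in> space M. \<bar>V \<omega>\<bar> \<le> e} \<le> ennreal (2 * K * e)"
proof -
  let ?B = "\<lambda>m. {\<omega> \<in> space M. \<bar>Y m \<omega>\<bar> \<le> 2 * e}"
  have "emeasure M {\<omega> \<in> space M. \<bar>V \<omega>\<bar> \<le> e} = (\<integral>\<^sup>+\<omega>. indicator {\<omega> \<in> space M. \<bar>V \<omega>\<bar> \<le> e} \<omega> \<partial>M)"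
    by simp
  also have "\<dots> \<le> (\<integral>\<^sup>+\<omega>. liminf (\<lambda>m. indicator (?B m) \<omega>) \<partial>M)"
  proof (rule nn_integral_mono_AE)
    show "AE \<omega> in M. indicator {\<omega> \<in> space M. \<bar>V \<omega>\<bar> \<le> e} \<omega> \<le> (liminf (\<lambda>m. indicator (?B m) \<omega>) :: ennreal)"
      using lim
    proof eventually_elim
      case (elim \<omega>)
      show ?case
      proof (cases "\<omega> \<in> {\<omega> \<in> space M. \<bar>V \<omega>\<bar> \<le> e}")
        case True
        have "(\<lambda>m. \<bar>Y m \<omega>\<bar>) \<longlonglongrightarrow> \<bar>V \<omega>\<bar>" using elim by (rule tendsto_rabs)
        then have "\<forall>\<^sub>F m in sequentially. \<bar>Y m \<omega>\<bar> < 2 * e" using True e by (intro order_tendstoD) auto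
        then have "\<forall>\<^sub>F m in sequentially. 1 \<le> (indicator (?B m) \<omega> :: ennreal)"
          by eventually_elim (use True in auto)
        then have "1 \<le> (liminf (\<lambda>m. indicator (?B m) \<omega>) :: ennreal)" by (rule Liminf_bounded)
        then show ?thesis using True by simp
      qed simp
    qed
  qed
  also have "\<dots> \<le> liminf (\<lambda>m. \<integral>\<^sup>+\<omega>. indicator (?B m) \<omega> \<partial>M)"
    by (rule nn_integral_liminf) measurable
  also have "\<dots> = liminf (\<lambda>m. emeasure M (?B m))" by simp
  also have "\<dots> \<le> limsup (\<lambda>m. emeasure M (?B m))" by (rule Liminf_le_Limsup) simp
  also have "\<dots> \<le> ennreal (K * (2 * e))"
    using e by (intro Limsup_bounded always_eventually allI bound) auto
  finally show ?thesis by (simp add: mult_ac)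
qed

text \<open>The range \<open>n + 2\<close> guarantees that the interval [1, 2] is covered, whose grid points alone
  carry the lower bound on the variance.\<close>

lemma discounted_riemann_sum_small_ball:
  assumes W: "wiener_process M W" and g: "\<gamma> > - 1" and \<theta>: "0 < \<theta>"
    and X: "\<And>t. 0 \<le> t \<Longrightarrow> has_wiener_integral M W (gaussian_kernel \<alpha> \<beta> \<gamma> t) (X t)"
  obtains K where "\<And>n m e. 0 < e \<Longrightarrow>
    emeasure M {\<omega> \<in> space M. \<bar>\<Sum>i<(n + 2) * Suc m.
      exp (- \<theta> * (real i / real (Suc m))) * X (real i / real (Suc m)) \<omega> / real (Suc m)\<bar> \<le> e} \<le> ennreal (K * e)"
proof -
  have "gaussian_kernel \<alpha> \<beta> \<gamma> 1 \<in> borel_measurable borel"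
    using X[of 1] by (simp add: has_wiener_integral_def)
  then obtain c where c: "0 < c" "ennreal (c\<^sup>2) \<le> (\<integral>\<^sup>+s\<in>{0..}. ennreal ((gaussian_kernel \<alpha> \<beta> \<gamma> 1 s)\<^sup>2) \<partial>lborel)"
    using gaussian_kernel_L2_pos[OF g, of \<alpha> \<beta> 1] by auto
  \<comment> \<open>exp (- 2 * \<theta>) is the smallest discount factor on [1, 2]. The constant
    must depend on neither n nor m, since both tend to infinity later.\<close>
  define c' where "c' = exp (- 2 * \<theta>) * c"
  have c': "0 < c'" using c by (simp add: c'_def)
  show thesis
  proof (rule that[of "4 / c'"])
    fix n m :: nat and e :: real assume e: "0 < e"
    define \<tau> where "\<tau> i = real i / real (Suc m)" for i
    define k where "k i s = (exp (- \<theta> * \<tau> i) / real (Suc m)) * gaussian_kernel \<alpha> \<beta> \<gamma> (\<tau> i) s" for i s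
    let ?N = "(n + 2) * Suc m"
    have int: "has_wiener_integral M W (\<lambda>s. \<Sum>i<?N. k i s) (\<lambda>\<omega>. \<Sum>i<?N. (exp (- \<theta> * \<tau> i) / real (Suc m)) * X (\<tau> i) \<omega>)"
      unfolding k_def
      by (intro has_wiener_integral_sum[OF W] has_wiener_integral_cmult[OF W] X) (auto simp: \<tau>_def)
    have k0: "0 \<le> k i s" for i s using gaussian_kernel_nonneg by (simp add: k_def)
    have lower: "exp (- 2 * \<theta>) * gaussian_kernel \<alpha> \<beta> \<gamma> 1 s \<le> (\<Sum>i<?N. k i s)" for s
    proof -
      \<comment> \<open>This range contains exactly Suc m grid points, those in [1, 2), so the sum
        cancels the mesh factor 1 / Suc m.\<close>
      have "exp (- 2 * \<theta>) * gaussian_kernel \<alpha> \<beta> \<gamma> 1 s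
          = (\<Sum>i\<in>{Suc m..<2 * Suc m}. exp (- 2 * \<theta>) / real (Suc m) * gaussian_kernel \<alpha> \<beta> \<gamma> 1 s)"
        by simp
      also have "\<dots> \<le> (\<Sum>i\<in>{Suc m..<2 * Suc m}. k i s)"
      proof (rule sum_mono)
        fix i assume i: "i \<in> {Suc m..<2 * Suc m}"
        then have "real (Suc m) \<le> real i" "real i \<le> real (2 * Suc m)" by (simp_all only: of_nat_le_iff) auto
        then have \<tau>: "1 \<le> \<tau> i" "\<tau> i \<le> 2" by (simp_all add: \<tau>_def field_simps)
        then have "exp (- 2 * \<theta>) \<le> exp (- \<theta> * \<tau> i)" using \<theta> by simp
        then show "exp (- 2 * \<theta>) / real (Suc m) * gaussian_kernel \<alpha> \<beta> \<gamma> 1 s \<le> k i s"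
          unfolding k_def using \<tau>
          by (intro mult_mono divide_right_mono gaussian_kernel_mono g gaussian_kernel_nonneg) auto
      qed
      also have "\<dots> \<le> (\<Sum>i<?N. k i s)" by (intro sum_mono2) (auto simp: k0)
      finally show ?thesis .
    qed
    have "ennreal (c'\<^sup>2) = ennreal ((exp (- 2 * \<theta>))\<^sup>2) * ennreal (c\<^sup>2)"
      by (simp add: c'_def power_mult_distrib ennreal_mult)
    also have "\<dots> \<le> ennreal ((exp (- 2 * \<theta>))\<^sup>2) * (\<integral>\<^sup>+s\<in>{0..}. ennreal ((gaussian_kernel \<alpha> \<beta> \<gamma> 1 s)\<^sup>2) \<partial>lborel)"
      by (intro mult_left_mono c) simp
    also have "\<dots> = (\<integral>\<^sup>+s. ennreal ((exp (- 2 * \<theta>))\<^sup>2) * (ennreal ((gaussian_kernel \<alpha> \<beta> \<gamma> 1 s)\<^sup>2) * indicator {0..} s) \<partial>lborel)"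
      using \<open>gaussian_kernel \<alpha> \<beta> \<gamma> 1 \<in> borel_measurable borel\<close> by (subst nn_integral_cmult) auto
    also have "\<dots> \<le> (\<integral>\<^sup>+s\<in>{0..}. ennreal ((\<Sum>i<?N. k i s)\<^sup>2) \<partial>lborel)"
    proof (rule nn_integral_mono)
      fix s :: real
      have "(exp (- 2 * \<theta>) * gaussian_kernel \<alpha> \<beta> \<gamma> 1 s)\<^sup>2 \<le> (\<Sum>i<?N. k i s)\<^sup>2"
        by (intro power_mono lower mult_nonneg_nonneg gaussian_kernel_nonneg) auto
      then have "ennreal ((exp (- 2 * \<theta>))\<^sup>2 * (gaussian_kernel \<alpha> \<beta> \<gamma> 1 s)\<^sup>2) \<le> ennreal ((\<Sum>i<?N. k i s)\<^sup>2)"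
        by (intro ennreal_leI) (simp add: power_mult_distrib)
      then show "ennreal ((exp (- 2 * \<theta>))\<^sup>2) * (ennreal ((gaussian_kernel \<alpha> \<beta> \<gamma> 1 s)\<^sup>2) * indicator {0..} s)
          \<le> ennreal ((\<Sum>i<?N. k i s)\<^sup>2) * indicator {0..} s"
        by (simp add: ennreal_mult mult.assoc[symmetric] mult_right_mono)
    qed
    finally have "emeasure M {\<omega> \<in> space M. \<bar>\<Sum>i<?N. (exp (- \<theta> * \<tau> i) / real (Suc m)) * X (\<tau> i) \<omega>\<bar> \<le> e} \<le> ennreal (4 * e / c')"
      by (intro has_wiener_integral_small_ball[OF W int c' _ e])
    then show "emeasure M {\<omega> \<in> space M. \<bar>\<Sum>i<?N.
      exp (- \<theta> * (real i / real (Suc m))) * X (real i / real (Suc m)) \<omega> / real (Suc m)\<bar> \<le> e} \<le> ennreal (4 / c' * e)"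
      unfolding \<tau>_def times_divide_eq_left .
  qed
qed

section \<open>Strong consistency on an event of full measure\<close>

theorem theorem4p2:
  fixes M :: "'a measure"
    and W X Z :: "real \<Rightarrow> 'a \<Rightarrow> real"
    and \<alpha> \<beta> \<gamma> \<theta> :: real
  assumes "\<alpha> > - 1 / 2" and "\<gamma> > - 1" and "\<alpha> + \<beta> + \<gamma> > - 3 / 2"
    and "wiener_process M W"
    and "continuous_volterra_process M W \<alpha> \<beta> \<gamma> X"
    and "\<theta> > 0"
    and "langevin_solution M \<theta> X Z"
  shows "AE \<omega> in M. ((\<lambda>T. theta_hat Z T \<omega>) \<longlongrightarrow> \<theta>) at_top"
proof -
  note W = \<open>wiener_process M W\<close> and \<theta> = \<open>\<theta> > 0\<close> and g = \<open>\<gamma> > - 1\<close>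
  have X: "\<And>t. 0 \<le> t \<Longrightarrow> has_wiener_integral M W (gaussian_kernel \<alpha> \<beta> \<gamma> t) (X t)"
    and cont: "AE \<omega> in M. continuous_on {0..} (\<lambda>t. X t \<omega>)"
    using assms by (auto simp: continuous_volterra_process_def)
  have meas: "X t \<in> borel_measurable M" if "0 \<le> t" for t
    using X[OF that] by (simp add: has_wiener_integral_def)
  obtain A p where A: "0 \<le> A" and kernel: "\<And>t t' R. 1 \<le> t \<Longrightarrow> t \<le> t' \<Longrightarrow> t' \<le> R \<Longrightarrow>
    (\<integral>\<^sup>+s\<in>{0..}. ennreal ((gaussian_kernel \<alpha> \<beta> \<gamma> t' s - gaussian_kernel \<alpha> \<beta> \<gamma> t s)\<^sup>2) \<partial>lborel)
      \<le> ennreal (A * R powr p * (t' - t) powr (1 + min 1 (\<gamma> + 1)))"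
    using gaussian_kernel_increment_L2[OF assms(1) g] by blast
  \<comment> \<open>The rate \<theta> / 2 is a choice: chaining gives every positive rate, and any
    rate below \<theta> would let the discounted integral converge.\<close>
  have growth: "AE \<omega> in M. \<exists>C. \<forall>t\<ge>0. \<bar>X t \<omega>\<bar> \<le> C * exp (\<theta> / 2 * t)"
  proof (rule AE_exponential_growth[OF meas cont])
    show "0 < min 1 (\<gamma> + 1)" "0 < \<theta> / 2" "0 \<le> 4 * A" using g \<theta> A by auto
    fix t t' R :: real assume t: "1 \<le> t" "t \<le> t'" "t' \<le> R"
    have "(\<integral>\<^sup>+\<omega>. ennreal ((X t' \<omega> - X t \<omega>)\<^sup>2) \<partial>M)
        \<le> 4 * (\<integral>\<^sup>+s\<in>{0..}. ennreal ((gaussian_kernel \<alpha> \<beta> \<gamma> t' s - gaussian_kernel \<alpha> \<beta> \<gamma> t s)\<^sup>2) \<partial>lborel)"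
      using t by (intro has_wiener_integral_second_moment[OF W] has_wiener_integral_diff[OF W] X) auto
    also have "\<dots> \<le> 4 * ennreal (A * R powr p * (t' - t) powr (1 + min 1 (\<gamma> + 1)))"
      by (intro mult_left_mono kernel t) auto
    also have "\<dots> = ennreal (4 * A * R powr p * (t' - t) powr (1 + min 1 (\<gamma> + 1)))"
      using A by (simp add: ennreal_mult mult.assoc)
    finally show "(\<integral>\<^sup>+\<omega>. ennreal ((X t' \<omega> - X t \<omega>)\<^sup>2) \<partial>M)
        \<le> ennreal (4 * A * R powr p * (t' - t) powr (1 + min 1 (\<gamma> + 1)))" .
  qed
  define R where "R n m \<omega> = (\<Sum>i<(n + 2) * Suc m.
      exp (- \<theta> * (real i / real (Suc m))) * X (real i / real (Suc m)) \<omega> / real (Suc m))" for n m \<omega>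
  \<comment> \<open>Taken as \<open>lim\<close> of measurable sequences, J and L are measurable on
    the whole space, whatever happens on the exceptional null set. For continuous paths J is the
    integral over [0, n + 2].\<close>
  define J where "J n \<omega> = lim (\<lambda>m. R n m \<omega>)" for n \<omega>
  define L where "L \<omega> = lim (\<lambda>n. J n \<omega>)" for \<omega>
  have [measurable]: "R n m \<in> borel_measurable M" for n m
    unfolding R_def by (intro borel_measurable_sum borel_measurable_divide borel_measurable_times meas) auto
  have [measurable]: "J n \<in> borel_measurable M" for n unfolding J_def by measurable
  have [measurable]: "L \<in> borel_measurable M" unfolding L_def by measurable
  have lim_R: "(\<lambda>m. R n m \<omega>) \<longlonglongrightarrow> integral {0..real (n + 2)} (\<lambda>s. exp (- \<theta> * s) * X s \<omega>)"
    if "continuous_on {0..} (\<lambda>t. X t \<omega>)" for n \<omega>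
    unfolding R_def using that
    by (intro riemann_sums_tendsto_integral continuous_intros) (auto elim: continuous_on_subset)
  have J_eq: "J n \<omega> = integral {0..real (n + 2)} (\<lambda>s. exp (- \<theta> * s) * X s \<omega>)"
    if "continuous_on {0..} (\<lambda>t. X t \<omega>)" for n \<omega>
    unfolding J_def by (rule limI[OF lim_R[OF that]])
  have lim_J: "((\<lambda>T. integral {0..T} (\<lambda>s. exp (- \<theta> * s) * X s \<omega>)) \<longlongrightarrow> L \<omega>) at_top" "(\<lambda>n. J n \<omega>) \<longlonglongrightarrow> L \<omega>"
    if c: "continuous_on {0..} (\<lambda>t. X t \<omega>)" and growth: "\<exists>C. \<forall>t\<ge>0. \<bar>X t \<omega>\<bar> \<le> C * exp (\<theta> / 2 * t)" for \<omega>
  proof -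
    obtain l where l: "((\<lambda>T. integral {0..T} (\<lambda>s. exp (- \<theta> * s) * X s \<omega>)) \<longlongrightarrow> l) at_top"
      using discounted_integral_converges[OF c \<theta>] growth by blast
    have "filterlim (\<lambda>n. real (n + 2)) at_top sequentially" by real_asymp
    from filterlim_compose[OF l this] have Jl: "(\<lambda>n. J n \<omega>) \<longlonglongrightarrow> l" by (simp add: J_eq[OF c])
    then have "L \<omega> = l" unfolding L_def by (rule limI)
    with l Jl show "((\<lambda>T. integral {0..T} (\<lambda>s. exp (- \<theta> * s) * X s \<omega>)) \<longlongrightarrow> L \<omega>) at_top" "(\<lambda>n. J n \<omega>) \<longlonglongrightarrow> L \<omega>"
      by auto
  qed
  obtain K where K: "\<And>n m e. 0 < e \<Longrightarrow> emeasure M {\<omega> \<in> space M. \<bar>R n m \<omega>\<bar> \<le> e} \<le> ennreal (K * e)"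
    unfolding R_def using discounted_riemann_sum_small_ball[OF W g \<theta> X] by blast
  have ball_J: "emeasure M {\<omega> \<in> space M. \<bar>J n \<omega>\<bar> \<le> e} \<le> ennreal (2 * K * e)" if "0 < e" for n e
  proof (rule small_ball_AE_limit[OF _ _ _ K that])
    show "AE \<omega> in M. (\<lambda>m. R n m \<omega>) \<longlonglongrightarrow> J n \<omega>"
      using cont by eventually_elim (use lim_R J_eq in simp)
  qed auto
  \<comment> \<open>Each of the two limits, first in the mesh and then in the horizon, doubles the
    constant. Letting e tend to 0 then shows that L has no atom at 0.\<close>
  have ball_L: "emeasure M {\<omega> \<in> space M. \<bar>L \<omega>\<bar> \<le> e} \<le> ennreal (2 * (2 * K) * e)" if "0 < e" for e
  proof (rule small_ball_AE_limit[OF _ _ _ ball_J that])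
    show "AE \<omega> in M. (\<lambda>n. J n \<omega>) \<longlonglongrightarrow> L \<omega>"
      using cont growth by eventually_elim (rule lim_J)
  qed auto
  have "emeasure M {\<omega> \<in> space M. L \<omega> = 0} \<le> 0"
  proof (rule LIMSEQ_le_const)
    have "(\<lambda>n. ennreal (2 * (2 * K) * inverse (real (Suc n)))) \<longlonglongrightarrow> ennreal (2 * (2 * K) * 0)"
      by (intro tendsto_ennrealI tendsto_mult tendsto_const LIMSEQ_inverse_real_of_nat)
    then show "(\<lambda>n. ennreal (2 * (2 * K) * inverse (real (Suc n)))) \<longlonglongrightarrow> 0" by simp
    show "\<exists>N. \<forall>n\<ge>N. emeasure M {\<omega> \<in> space M. L \<omega> = 0} \<le> ennreal (2 * (2 * K) * inverse (real (Suc n)))"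
    proof (intro exI allI impI)
      fix n
      have "emeasure M {\<omega> \<in> space M. L \<omega> = 0} \<le> emeasure M {\<omega> \<in> space M. \<bar>L \<omega>\<bar> \<le> inverse (real (Suc n))}"
        by (intro emeasure_mono) auto
      also have "\<dots> \<le> ennreal (2 * (2 * K) * inverse (real (Suc n)))" by (rule ball_L) simp
      finally show "emeasure M {\<omega> \<in> space M. L \<omega> = 0} \<le> ennreal (2 * (2 * K) * inverse (real (Suc n)))" .
    qed
  qed
  then have "AE \<omega> in M. L \<omega> \<noteq> 0" by (intro AE_I[where N = "{\<omega> \<in> space M. L \<omega> = 0}"]) auto
  moreover have "AE \<omega> in M. \<forall>t\<ge>0. set_integrable lborel {0..t} (\<lambda>s. Z s \<omega>) \<and>
      Z t \<omega> = \<theta> * (LBINT s:{0..t}. Z s \<omega>) + X t \<omega>"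
    using assms by (simp add: langevin_solution_def)
  ultimately show ?thesis
    using cont growth
  proof eventually_elim
    case (elim \<omega>)
    then obtain C where C: "\<And>t. 0 \<le> t \<Longrightarrow> \<bar>X t \<omega>\<bar> \<le> C * exp (\<theta> / 2 * t)" by blast
    show ?case unfolding theta_hat_def
      using elim by (intro langevin_path_ratio_tendsto[OF \<theta> elim(3) _ C lim_J(1)]) auto
  qed
qed

end
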